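(* Let $\mathcal{G}_4(x)=e^{\mathcal{K}(\sqrt{x})}-\frac{4}{\sqrt{1-x}}$ for $x\in(0,1)$. The function $$\mathcal{H}(x)=\frac{\mathcal{G}_4(x)-\mathcal{G}_4(1-x)}{1-2x}=\frac{1}{1-2x}\left[e^{\mathcal{K}(\sqrt{x})}-e^{\mathcal{K}(\sqrt{1-x})}+\frac{4}{\sqrt{x}}-\frac{4}{\sqrt{1-x}}\right]$$ is completely monotonic on $(0,1/2)$ and absolutely monotonic on $(1/2,1)$. Consequently, the double inequality $$\beta(1-2r^2)<e^{\mathcal{K}(r)}-e^{\mathcal{K}(r')}+\frac{4}{r}-\frac{4}{r'}<\alpha(1-2r^2)$$ holds for all $r\in(0,1/\sqrt{2})$ with the best constants $\alpha=e^{\pi/2}-4\approx0.810$ and $$\beta=4\sqrt{2}-\frac{1}{\sqrt{\pi}}\Gamma\left(\tfrac34\right)^2\exp\left(\frac{\Gamma(1/4)^2}{4\sqrt{\pi}}\right)\approx0.246$$ (that is, $\alpha$ cannot be replaced by a smaller constant nor $\beta$ by a larger one). The double inequality is reversed for $r\in(1/\sqrt{2},1)$.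
   Context: $\mathcal{K}(r)=\int_0^{\pi/2}\frac{dt}{\sqrt{1-r^2\sin^2 t}}$ for $r\in(0,1)$ is the complete elliptic integral of the first kind; $r'=\sqrt{1-r^2}$; $\Gamma$ is the gamma function. A function $f$ is absolutely monotonic on an interval $I$ if it is infinitely differentiable there and $f^{(j)}(x)\ge0$ for all $x\in I$ and all integers $j\ge0$; it is completely monotonic on $I$ if it is infinitely differentiable there and $(-1)^jf^{(j)}(x)\ge0$ for all $x\in I$ and all integers $j\ge0$. *)

theory Defs
  imports "HOL-Analysis.Analysis"
begin

definition elliptic_K :: "real \<Rightarrow> real" where
  "elliptic_K r = integral {0..pi / 2} (\<lambda>t. 1 / sqrt (1 - r\<^sup>2 * (sin t)\<^sup>2))"

text \<open>
  The derivatives below are two-sided, so the following three notions are meant for open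
  intervals \<open>I\<close> (for other intervals one would need one-sided derivatives at the endpoints).
\<close>

definition infinitely_differentiable_on :: "(real \<Rightarrow> real) \<Rightarrow> real set \<Rightarrow> bool" where
  "infinitely_differentiable_on f I \<longleftrightarrow>
     (\<forall>j. \<forall>x\<in>I. (deriv ^^ j) f differentiable (at x))"

definition absolutely_monotonic_on :: "(real \<Rightarrow> real) \<Rightarrow> real set \<Rightarrow> bool" where
  "absolutely_monotonic_on f I \<longleftrightarrow>
     infinitely_differentiable_on f I \<and> (\<forall>j. \<forall>x\<in>I. (deriv ^^ j) f x \<ge> 0)"

definition completely_monotonic_on :: "(real \<Rightarrow> real) \<Rightarrow> real set \<Rightarrow> bool" where
  "completely_monotonic_on f I \<longleftrightarrow>
     infinitely_differentiable_on f I \<and> (\<forall>j. \<forall>x\<in>I. (-1) ^ j * (deriv ^^ j) f x \<ge> 0)"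

definition G4 :: "real \<Rightarrow> real" where
  "G4 x = exp (elliptic_K (sqrt x)) - 4 / sqrt (1 - x)"

definition H_fun :: "real \<Rightarrow> real" where
  "H_fun x = (G4 x - G4 (1 - x)) / (1 - 2 * x)"

definition K_diff :: "real \<Rightarrow> real" where
  "K_diff r = exp (elliptic_K r) - exp (elliptic_K (sqrt (1 - r\<^sup>2))) + 4 / r - 4 / sqrt (1 - r\<^sup>2)"

end

theory Submission
  imports Defs
begin

text \<open>
  Write \<open>K(x)\<close> for the complete elliptic integral of modulus \<open>sqrt x\<close>. Everything follows from one
  sign pattern: \<open>G4 x = exp (pi / 2) - 4 - (a\<^sub>1 x + a\<^sub>2 x\<^sup>2 + \<dots>)\<close> with \<open>a\<^sub>n > 0\<close> for all \<open>n \<ge> 1\<close>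
  (lemma \<open>G4_drop_pos\<close>). Indeed \<open>H_fun (1/2 + s)\<close> is then the sum of the terms
  \<open>a\<^sub>n ((1/2 + s)\<^sup>n - (1/2 - s)\<^sup>n) / (2 s)\<close>, each of which is an even polynomial in \<open>s\<close> with nonnegative
  coefficients. Hence \<open>H_fun\<close> is an even power series in \<open>s = x - 1/2\<close> with nonnegative coefficients,
  convergent for \<open>\<bar>s\<bar> < 1/2\<close> (\<open>H_coeff_sums\<close>). Differentiating it termwise gives both monotonicity
  claims. The series increases strictly with \<open>\<bar>s\<bar>\<close>, so its limits at \<open>s = 0\<close> and \<open>\<bar>s\<bar> = 1/2\<close> are the best
  constants. The limit at \<open>\<bar>s\<bar> = 1/2\<close> is \<open>G4 0 = exp (pi / 2) - 4\<close> because \<open>G4\<close> vanishes at \<open>1\<close>. The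
  limit at \<open>s = 0\<close> is \<open>- G4'(1/2)\<close>, which Legendre's relation reduces to the lemniscatic value
  \<open>K(1/2)\<close>, a Beta integral.

  The sign pattern compares \<open>u\<^sub>n\<close>, the coefficients of \<open>F = exp (K - pi / 2)\<close>, with the coefficients
  \<open>W\<^sub>n\<close> of \<open>1 / sqrt (1 - x)\<close>: it says \<open>exp (pi / 2) u\<^sub>n < 4 W\<^sub>n\<close> for \<open>n \<ge> 1\<close> (it fails at \<open>n = 0\<close>). The
  quotient \<open>u\<^sub>n / W\<^sub>n\<close> is strictly increasing from \<open>n = 1\<close> on (\<open>ratio_gap_pos\<close>), so if the inequality
  failed once, \<open>G4 x\<close> would exceed a positive multiple of \<open>1 / sqrt (1 - x)\<close> near \<open>1\<close>. But \<open>G4\<close> tends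
  to \<open>0\<close> there, by explicit logarithmic bounds for the elliptic integral (\<open>elliptic_K_bounds\<close>).

  The growth of \<open>u\<^sub>n / W\<^sub>n\<close> is the sign of \<open>C\<^sub>n = 2 (n + 1) u\<^sub>n\<^sub>+\<^sub>1 - (2 n + 1) u\<^sub>n\<close>. These numbers have the
  generating function \<open>F q\<close> with \<open>q = 2 (1 - x) K' - 1\<close>. The coefficients of \<open>q\<close> sum to \<open>0\<close>, the
  constant one being negative and all others positive, so that \<open>C\<^sub>n\<close> is a difference of nearly equal
  quantities and cannot be estimated directly. Differentiating once more gives
  \<open>2 (1 - x) (F q)' = (q - 1) F q + F p\<close> with \<open>p = 2 q + 2 (1 - x) q'\<close>. This is a recurrence for \<open>C\<^sub>n\<close>
  (\<open>ratio_gap_rec\<close>) that propagates positivity as soon as the coefficients of \<open>F p\<close> outweigh one small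
  negative term. The coefficients of \<open>p\<close> again sum to \<open>0\<close>, but they decay one order faster than those
  of \<open>q\<close>, and crude estimates now suffice: the positive contribution of the first and the last term
  of the convolution already dominates.
\<close>

section \<open>Wallis coefficients\<close>

text \<open>
  The coefficients of \<open>1 / sqrt (1 - x)\<close>; up to the factor \<open>pi / 2\<close> they are also the integrals of
  the even powers of the sine over \<open>{0..pi / 2}\<close>.
\<close>
definition wallis_coeff :: "nat \<Rightarrow> real" where
  "wallis_coeff n = pochhammer (1/2) n / fact n"

text \<open>
  The coefficients of \<open>2 x K'(x)\<close>. Up to a factor tending to \<open>1\<close>, this is the limit \<open>pi / 2\<close> of
  Wallis's product divided by its partial products.
\<close>
definition wallis_ratio :: "nat \<Rightarrow> real" where
  "wallis_ratio n = pi * real n * (wallis_coeff n)\<^sup>2"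

text \<open>
  The coefficients of \<open>2 (1 - x) K'(x)\<close>. They are the increments of \<open>wallis_ratio\<close>, which is why all
  partial sums below have closed forms.
\<close>
definition wallis_step :: "nat \<Rightarrow> real" where
  "wallis_step n = pi * (wallis_coeff n)\<^sup>2 / (4 * (real n + 1))"

lemma wallis_coeff_0 [simp]: "wallis_coeff 0 = 1"
  by (simp add: wallis_coeff_def)

lemma wallis_coeff_Suc: "wallis_coeff (Suc n)
    = wallis_coeff n * (2 * real n + 1) / (2 * real n + 2)"
  by (simp add: wallis_coeff_def pochhammer_Suc field_simps)

lemma wallis_coeff_pos: "wallis_coeff n > 0"
  by (induction n) (auto simp: wallis_coeff_Suc)

lemma wallis_coeff_Suc_le: "wallis_coeff (Suc n) \<le> wallis_coeff n"
  using wallis_coeff_pos[of n] by (simp add: wallis_coeff_Suc field_simps)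

lemma decseq_wallis_coeff: "decseq wallis_coeff"
  using wallis_coeff_Suc_le by (rule decseq_SucI)

lemma wallis_ratio_0 [simp]: "wallis_ratio 0 = 0"
  by (simp add: wallis_ratio_def)

lemma wallis_step_pos: "wallis_step n > 0"
  using wallis_coeff_pos[of n] by (simp add: wallis_step_def)

lemma wallis_step_nonneg: "wallis_step n \<ge> 0"
  by (simp add: wallis_step_def)

lemma wallis_ratio_Suc_diff: "wallis_ratio (Suc n) - wallis_ratio n = wallis_step n"
proof -
  have "wallis_ratio (Suc n) = pi * (wallis_coeff n)\<^sup>2 * (2 * real n + 1)\<^sup>2 / (4 * (real n + 1))"
    by (simp add: wallis_ratio_def wallis_coeff_Suc divide_simps power2_eq_square) algebra
  then show ?thesis
    by (simp add: wallis_ratio_def wallis_step_def divide_simps power2_eq_square) algebra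
qed

lemma wallis_step_eq_ratio: "n > 0 \<Longrightarrow> wallis_step n = wallis_ratio n / (4 * real n * (real n + 1))"
  by (simp add: wallis_ratio_def wallis_step_def divide_simps)

lemma wallis_step_Suc: "wallis_step (Suc n)
    = wallis_step n * (2 * real n + 1)\<^sup>2 / (4 * (real n + 1) * (real n + 2))"
proof -
  have "wallis_step (Suc n) = pi
      * (wallis_coeff n * (2 * real n + 1) / (2 * real n + 2))\<^sup>2 / (4 * (real n + 2))"
    by (simp add: wallis_step_def wallis_coeff_Suc algebra_simps)
  also have "\<dots> = wallis_step n * (2 * real n + 1)\<^sup>2 / (4 * (real n + 1) * (real n + 2))"
    unfolding wallis_step_def power_divide power_mult_distrib
    by (simp add: divide_simps power2_eq_square) (simp add: algebra_simps)
  finally show ?thesis .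
qed

lemma mono_wallis_ratio: "mono wallis_ratio"
proof (rule incseq_SucI)
  show "wallis_ratio n \<le> wallis_ratio (Suc n)" for n
    using wallis_ratio_Suc_diff[of n] wallis_step_pos[of n] by linarith
qed

lemma wallis_product_eq:
  "(\<Prod>k=1..n. (4 * real k ^ 2) / (4 * real k ^ 2 - 1)) = 1 / ((wallis_coeff n)\<^sup>2 * (2 * real n + 1))"
proof (induction n)
  case (Suc n)
  have *: "4 * real (Suc n) ^ 2 - 1 = (2 * real n + 1) * (2 * real n + 3)"
    by (simp add: power2_eq_square algebra_simps)
  have "(\<Prod>k=1..Suc n. (4 * real k ^ 2) / (4 * real k ^ 2 - 1)) =
        1 / ((wallis_coeff n)\<^sup>2 * (2 * real n + 1)) * (4 * real (Suc n) ^ 2 / ((2 * real n + 1) *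
            (2 * real n + 3)))"
    unfolding *[symmetric] Suc[symmetric] by simp
  also have "\<dots> = 1 / ((wallis_coeff (Suc n))\<^sup>2 * (2 * real (Suc n) + 1))"
    using wallis_coeff_pos[of n] by (simp add: wallis_coeff_Suc divide_simps power2_eq_square)
        (simp add: algebra_simps)
  finally show ?case .
qed auto

lemma wallis_ratio_tendsto_1: "wallis_ratio \<longlonglongrightarrow> 1"
proof -
  let ?p = "\<lambda>n. \<Prod>k=1..n. (4 * real k ^ 2) / (4 * real k ^ 2 - 1)"
  have "(\<lambda>n. real n / (2 * real n + 1)) \<longlonglongrightarrow> 1 / 2"
    by real_asymp
  then have "(\<lambda>n. pi * (real n / (2 * real n + 1)) / ?p n) \<longlonglongrightarrow> pi * (1/2) / (pi / 2)"
    by (rule tendsto_divide[OF tendsto_mult[OF tendsto_const] wallis]) auto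
  moreover have "pi * (real n / (2 * real n + 1)) / ?p n = wallis_ratio n" for n
    using wallis_coeff_pos[of n] unfolding wallis_product_eq wallis_ratio_def by
        (simp add: field_simps)
  ultimately show ?thesis by simp
qed

lemma wallis_ratio_le_1: "wallis_ratio n \<le> 1"
  using mono_wallis_ratio wallis_ratio_tendsto_1 incseq_le by blast

lemma wallis_step_le: "n > 0 \<Longrightarrow> wallis_step n \<le> 1 / (4 * real n * (real n + 1))"
  using wallis_ratio_le_1[of n] by (simp add: wallis_step_eq_ratio divide_right_mono)

section \<open>Coefficients of the exponential and their recurrence\<close>

text \<open>
  The coefficients of \<open>F = exp (K - pi / 2)\<close>: the recursion compares coefficients in \<open>2 F' = 2 K' F\<close>.
\<close>
fun expK_coeff :: "nat \<Rightarrow> real" where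
  "expK_coeff 0 = 1"
| "expK_coeff (Suc n) = (\<Sum>i=0..n. wallis_ratio (Suc i) * expK_coeff (n - i)) / (2 * (real n + 1))"

lemma expK_coeff_pos: "expK_coeff n > 0"
proof (induction n rule: less_induct)
  case (less n)
  show ?case
  proof (cases n)
    case (Suc k)
    have "wallis_ratio (Suc i) > 0" for i
      using wallis_coeff_pos[of "Suc i"] by (simp add: wallis_ratio_def)
    then have "(\<Sum>i=0..k. wallis_ratio (Suc i) * expK_coeff (k - i)) > 0"
      using less Suc by (intro sum_pos) auto
    with Suc show ?thesis by simp
  qed simp
qed

lemma expK_coeff_le_1: "expK_coeff n \<le> 1"
proof (induction n rule: less_induct)
  case (less n)
  show ?case
  proof (cases n)
    case (Suc k)
    have "wallis_ratio (Suc i) * expK_coeff (k - i) \<le> 1 * 1" for i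
      using wallis_ratio_le_1 less Suc expK_coeff_pos[of "k - i"] by (intro mult_mono) auto
    then have "(\<Sum>i=0..k. wallis_ratio (Suc i) * expK_coeff (k - i)) \<le> (\<Sum>i=0..k. 1)"
      by (intro sum_mono) simp
    with Suc show ?thesis by (simp add: field_simps)
  qed simp
qed

text \<open>
  Positive exactly where \<open>expK_coeff n / wallis_coeff n\<close> grows from \<open>n\<close> to \<open>n + 1\<close>; the generating
  function is \<open>2 (1 - x) F' - F\<close>.
\<close>
definition ratio_gap :: "nat \<Rightarrow> real" where
  "ratio_gap n = 2 * (real n + 1) * expK_coeff (Suc n) - (2 * real n + 1) * expK_coeff n"

text \<open>
  The coefficients of \<open>q = 2 (1 - x) K' - 1\<close>, the quotient of the generating functions of \<open>ratio_gap\<close>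
  and \<open>expK_coeff\<close>.
\<close>
definition gap_factor :: "nat \<Rightarrow> real" where
  "gap_factor n = (if n = 0 then wallis_step 0 - 1 else wallis_step n)"

text \<open>
  The coefficients of \<open>p = 2 q + 2 (1 - x) q'\<close>. The two-term recurrence of \<open>wallis_step\<close> collapses
  them to a single positive term for \<open>n > 0\<close>, of order \<open>1 / n\<^sup>3\<close> instead of \<open>1 / n\<^sup>2\<close>.
\<close>
definition gap_source :: "nat \<Rightarrow> real" where
  "gap_source n = (if n = 0 then 2 * (wallis_step 0 - 1) + 2 * wallis_step 1 else 9
      * wallis_step n / (2 * (real n + 2)))"

lemma two_mult_nth: "fps_nth (2 * f) n = (2 * fps_nth f n :: real)"
  by (simp add: numeral_fps_const)

lemma expK_fps_deriv: "2 * fps_deriv (Abs_fps expK_coeff)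
    = Abs_fps (\<lambda>n. wallis_ratio (Suc n)) * Abs_fps expK_coeff"
proof (rule fps_ext)
  fix n
  have "2 * ((1 + real n) * expK_coeff (Suc n))
      = (\<Sum>i=0..n. wallis_ratio (Suc i) * expK_coeff (n - i))"
    by (simp add: divide_simps)
  then show "fps_nth (2 * fps_deriv (Abs_fps expK_coeff)) n =
      fps_nth (Abs_fps (\<lambda>n. wallis_ratio (Suc n)) * Abs_fps expK_coeff) n"
    unfolding two_mult_nth by (simp add: fps_mult_nth del: expK_coeff.simps)
qed

lemma one_minus_X_mult_nth: "fps_nth ((1 - fps_X) * f) n
    = (fps_nth f n - (if n = 0 then 0 else fps_nth f (n - 1)) :: real)"
  by (simp add: algebra_simps)

lemma one_minus_X_wallis_ratio: "(1 - fps_X) * Abs_fps (\<lambda>n. wallis_ratio (Suc n))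
    = 1 + Abs_fps gap_factor"
  by (rule fps_ext) (simp add: one_minus_X_mult_nth gap_factor_def
      wallis_ratio_Suc_diff[symmetric] del: of_nat_Suc)

lemma ratio_gap_fps_deriv: "Abs_fps ratio_gap
    = 2 * ((1 - fps_X) * fps_deriv (Abs_fps expK_coeff)) - Abs_fps expK_coeff"
proof (rule fps_ext)
  fix n show "fps_nth (Abs_fps ratio_gap) n
      = fps_nth (2 * ((1 - fps_X) * fps_deriv (Abs_fps expK_coeff)) - Abs_fps expK_coeff) n"
    unfolding fps_sub_nth two_mult_nth one_minus_X_mult_nth
    by (cases n) (simp_all add: ratio_gap_def algebra_simps del: expK_coeff.simps)
qed

lemma ratio_gap_fps: "Abs_fps ratio_gap = Abs_fps gap_factor * Abs_fps expK_coeff"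
proof -
  have "Abs_fps ratio_gap = (1 - fps_X) * (2 * fps_deriv (Abs_fps expK_coeff)) - Abs_fps expK_coeff"
    unfolding ratio_gap_fps_deriv by (simp add: algebra_simps)
  also have "\<dots> = ((1 - fps_X) * Abs_fps (\<lambda>n. wallis_ratio (Suc n))) * Abs_fps expK_coeff
      - Abs_fps expK_coeff"
    unfolding expK_fps_deriv by (simp add: mult.assoc)
  also have "\<dots> = Abs_fps gap_factor * Abs_fps expK_coeff"
    unfolding one_minus_X_wallis_ratio by (simp add: algebra_simps)
  finally show ?thesis .
qed

lemma ratio_gap_conv: "ratio_gap n = (\<Sum>i=0..n. gap_factor i * expK_coeff (n - i))"
  using arg_cong[OF ratio_gap_fps, of "\<lambda>f. fps_nth f n"] by (simp add: fps_mult_nth)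

lemma gap_source_fps: "Abs_fps gap_source
    = 2 * Abs_fps gap_factor + 2 * ((1 - fps_X) * fps_deriv (Abs_fps gap_factor))"
proof (rule fps_ext)
  fix n
  have "gap_source n = 2 * gap_factor n + 2 * (real (Suc n) * gap_factor (Suc n) - (if n
      = 0 then 0 else real n * gap_factor n))"
  proof (cases "n = 0")
    case False
    have "real (Suc n) * wallis_step (Suc n)
        = wallis_step n * (2 * real n + 1)\<^sup>2 / (4 * (real n + 2))"
      by (simp add: wallis_step_Suc divide_simps) (simp add: algebra_simps)
    then have "2 * wallis_step n + 2
        * (real (Suc n) * wallis_step (Suc n) - real n * wallis_step n) = 9 * wallis_step n / (2
            * (real n + 2))"
      by (simp only:) (simp add: divide_simps, simp add: algebra_simps power2_eq_square)
    with False show ?thesis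
      by (simp add: gap_source_def gap_factor_def)
  qed (simp add: gap_source_def gap_factor_def)
  then show "fps_nth (Abs_fps gap_source) n
      = fps_nth (2 * Abs_fps gap_factor + 2 * ((1 - fps_X) * fps_deriv (Abs_fps gap_factor))) n"
    unfolding fps_add_nth two_mult_nth one_minus_X_mult_nth
    by (cases n) (simp_all del: of_nat_Suc)
qed

text \<open>
  With \<open>F\<close> for the generating function of \<open>expK_coeff\<close>, differentiating \<open>F q\<close> produces \<open>F' q + F q'\<close>, and
  \<open>2 (1 - x) F' = F q + F\<close>; the remaining terms assemble to \<open>F p\<close>. The coefficient \<open>2 n - 1\<close> makes the
  recurrence preserve positivity if its last two sums do no harm.
\<close>
lemma ratio_gap_rec: "2 * (real n + 1) * ratio_gap (Suc n) = (2 * real n - 1) * ratio_gap n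
   + (\<Sum>i=0..n. gap_factor i * ratio_gap (n - i)) + (\<Sum>i=0..n. gap_source i * expK_coeff (n - i))"
proof -
  let ?C = "Abs_fps ratio_gap" and ?u = "Abs_fps expK_coeff" and ?q = "Abs_fps gap_factor"
      and ?p = "Abs_fps gap_source"
  let ?Y = "1 - fps_X :: real fps"
  have "fps_deriv ?C = fps_deriv ?q * ?u + ?q * fps_deriv ?u"
    by (simp add: ratio_gap_fps algebra_simps)
  then have "2 * (?Y * fps_deriv ?C) =
      (2 * (?Y * fps_deriv ?q)) * ?u + ?q * (2 * (?Y * fps_deriv ?u))"
    by (simp add: algebra_simps)
  also have "2 * (?Y * fps_deriv ?q) = ?p - 2 * ?q"
    unfolding gap_source_fps by simp
  also have "2 * (?Y * fps_deriv ?u) = ?C + ?u"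
    unfolding ratio_gap_fps_deriv by simp
  also have "(?p - 2 * ?q) * ?u + ?q * (?C + ?u) = ?p * ?u - ?q * ?u + ?q * ?C"
    by (simp add: algebra_simps)
  also have "?q * ?u = ?C"
    by (simp add: ratio_gap_fps)
  finally have "2 * (?Y * fps_deriv ?C) = ?q * ?C - ?C + ?p * ?u"
    by simp
  then have "fps_nth (2 * (?Y * fps_deriv ?C)) n = fps_nth (?q * ?C - ?C + ?p * ?u) n"
    by simp
  moreover have "fps_nth (2 * (?Y * fps_deriv ?C)) n
      = 2 * (real n + 1) * ratio_gap (Suc n) - 2 * real n * ratio_gap n"
    unfolding two_mult_nth one_minus_X_mult_nth by (cases n) (simp_all add: algebra_simps)
  moreover have "fps_nth (?q * ?C - ?C + ?p * ?u) n =
      (\<Sum>i=0..n. gap_factor i * ratio_gap (n - i)) - ratio_gap n + (\<Sum>i=0..n. gap_source i *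
        expK_coeff (n - i))"
    by (simp add: fps_mult_nth)
  ultimately have "2 * (real n + 1) * ratio_gap (Suc n) - 2 * real n * ratio_gap n =
      (\<Sum>i=0..n. gap_factor i * ratio_gap (n - i)) - ratio_gap n + (\<Sum>i=0..n. gap_source i *
        expK_coeff (n - i))"
    by (simp only:)
  then show ?thesis
    unfolding left_diff_distrib by linarith
qed

declare expK_coeff.simps(2) [simp del]

section \<open>Growth of the coefficients relative to the Wallis coefficients\<close>

lemma pi_bounds: "157 / 50 \<le> pi" "pi \<le> 63 / 20"
  using pi_approx by simp_all

lemma expK_coeff_1: "expK_coeff 1 = pi / 8"
  by (simp add: wallis_ratio_def wallis_coeff_Suc power2_eq_square expK_coeff.simps(2))

lemma wallis_step_0: "wallis_step 0 = pi / 4" and wallis_step_1: "wallis_step 1 = pi / 32"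
  by (simp_all add: wallis_step_def wallis_coeff_Suc power2_eq_square)

lemma ratio_gap_0: "ratio_gap 0 = pi / 4 - 1"
  by (simp add: ratio_gap_conv gap_factor_def wallis_step_0)

text \<open>
  The induction for \<open>ratio_gap_pos\<close> starts here, and its start amounts to \<open>pi > 3\<close>.
\<close>
lemma ratio_gap_1: "ratio_gap 1 = pi / 32 * (pi - 3)"
  using expK_coeff_1 by (simp add: ratio_gap_conv gap_factor_def wallis_step_0
      wallis_step_1[simplified] algebra_simps)

lemma expK_coeff_Suc_eq: "2 * (real n + 1) * expK_coeff (Suc n)
    = (2 * real n + 1) * expK_coeff n + ratio_gap n"
  by (simp add: ratio_gap_def)

text \<open>
  The partial sums are explicit because \<open>wallis_step\<close> telescopes, and so does \<open>(1 - x) q'\<close>.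
\<close>
lemma sum_gap_source: "(\<Sum>i=0..n. gap_source i)
    = 2 * (real n + 1) * wallis_step (Suc n) - 2 * (1 - wallis_ratio (Suc n))"
proof (induction n)
  case 0
  show ?case using wallis_ratio_Suc_diff[of 0] by (simp add: gap_source_def)
next
  case (Suc n)
  have "gap_source (Suc n) = 2 * wallis_step (Suc n) + 2
      * ((real n + 2) * wallis_step (Suc (Suc n)) - (real n + 1) * wallis_step (Suc n))"
    by (simp add: gap_source_def wallis_step_Suc[of "Suc n"] divide_simps)
        (simp add: algebra_simps power2_eq_square)
  with Suc show ?case
    using wallis_ratio_Suc_diff[of "Suc n"] by (simp add: algebra_simps)
qed

lemma sum_gap_source_tendsto_0: "(\<lambda>n. \<Sum>i=0..n. gap_source i) \<longlonglongrightarrow> 0"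
proof -
  have "(\<lambda>n. wallis_ratio (Suc n)) \<longlonglongrightarrow> 1"
    using wallis_ratio_tendsto_1 by (rule LIMSEQ_Suc)
  moreover have "(\<lambda>n. 1 / (2 * (real n + 2))) \<longlonglongrightarrow> 0"
    by real_asymp
  ultimately have "(\<lambda>n. wallis_ratio (Suc n) * (1 / (2 * (real n + 2))) - 2
      * (1 - wallis_ratio (Suc n))) \<longlonglongrightarrow> 1 * 0 - 2 * (1 - 1)"
    by (intro tendsto_intros)
  moreover have "wallis_ratio (Suc n) * (1 / (2 * (real n + 2)))
      = 2 * (real n + 1) * wallis_step (Suc n)" for n
    by (simp add: wallis_step_eq_ratio divide_simps) (simp add: algebra_simps)
  ultimately show ?thesis
    unfolding sum_gap_source by simp
qed

text \<open>
  The tail of \<open>gap_source\<close> is at most the corresponding tail of \<open>9 / (8 n (n + 1) (n + 2))\<close>. Instead of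
  summing tails, the proof notes that the difference of the two sides decreases to \<open>0\<close>.
\<close>
lemma sum_gap_source_ge: "(\<Sum>i=0..n. gap_source i) \<ge> - 9 / (16 * (real n + 1) * (real n + 2))"
proof -
  define R where "R = (\<lambda>n. (\<Sum>i=0..n. gap_source i) + 9 / (16 * (real n + 1) * (real n + 2)))"
  have "decseq R"
  proof (rule decseq_SucI)
    fix n
    have "gap_source (Suc n) \<le> 9 / (8 * (real n + 1) * (real n + 2) * (real n + 3))"
    proof -
      have "gap_source (Suc n) = wallis_step (Suc n) * (9 / (2 * (real n + 3)))"
        by (simp add: gap_source_def add.commute)
      also have "\<dots> \<le> 1 / (4 * (real n + 1) * (real n + 2)) * (9 / (2 * (real n + 3)))"
        using wallis_step_le[of "Suc n"] by (intro mult_right_mono) (auto simp: algebra_simps)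
      also have "\<dots> = 9 / (8 * (real n + 1) * (real n + 2) * (real n + 3))"
        by (simp add: divide_simps) (simp add: algebra_simps)
      finally show ?thesis .
    qed
    also have "\<dots> = 9 / (16 * (real n + 1) * (real n + 2)) - 9 / (16 * (real n + 2) * (real n + 3))"
      by (simp add: divide_simps) (simp add: algebra_simps)
    finally show "R (Suc n) \<le> R n"
      by (simp add: R_def algebra_simps)
  qed
  moreover have "R \<longlonglongrightarrow> 0"
  proof -
    have "(\<lambda>n. 9 / (16 * (real n + 1) * (real n + 2))) \<longlonglongrightarrow> 0"
      by real_asymp
    from tendsto_add[OF sum_gap_source_tendsto_0 this] show ?thesis
      by (simp only: R_def add_0_right)
  qed
  ultimately have "R n \<ge> 0"
    by (rule decseq_ge)
  then show ?thesis
    by (simp add: R_def)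
qed

lemma sum_inverse_consecutive: "(\<Sum>i=1..<Suc n. 1 / (real i * (real i + 1))) = 1 - 1 / (real n + 1)"
proof (induction n)
  case (Suc n)
  have "(\<Sum>i=1..<Suc (Suc n). 1 / (real i * (real i + 1))) =
      1 - 1 / (real n + 1) + 1 / ((real n + 1) * (real n + 2))"
    using Suc by (simp add: add.commute)
  also have "\<dots> = 1 - 1 / (real (Suc n) + 1)"
    by (simp add: divide_simps) (simp add: algebra_simps)
  finally show ?case .
qed simp

text \<open>
  The product \<open>(n - i) (i + 1)\<close> is concave in \<open>i\<close>, so it is at least \<open>2 (n - 1)\<close> for
  \<open>1 \<le> i \<le> n - 2\<close>; only the summand \<open>i = n - 1\<close> is larger.
\<close>
lemma sum_inverse_opposite_le:
  assumes "n \<ge> 2"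
  shows "(\<Sum>i=1..<n. 1 / ((real n - real i) * (real i + 1)))
      \<le> 1 / n + (real n - 2) / (2 * (real n - 1))"
proof -
  obtain k where k: "n = Suc (Suc k)"
    using assms by (metis add_2_eq_Suc le_Suc_ex)
  have "(\<Sum>i=1..<Suc k. 1 / ((real n - real i) * (real i + 1)))
      \<le> (\<Sum>i=1..<Suc k. 1 / (2 * (real n - 1)))"
  proof (rule sum_mono)
    fix i assume i: "i \<in> {1..<Suc k}"
    have "2 * (real n - 1) \<le> (real n - real i) * (real i + 1)"
    proof -
      have "(real i - 1) * (real n - 2 - real i) \<ge> 0"
        using i k by (intro mult_nonneg_nonneg) auto
      then show ?thesis by (simp add: algebra_simps)
    qed
    with assms show "1 / ((real n - real i) * (real i + 1)) \<le> 1 / (2 * (real n - 1))"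
      by (intro divide_left_mono mult_pos_pos) (use i k in auto)
  qed
  with k show ?thesis
    by (simp add: sum.atLeastLessThan_Suc algebra_simps)
qed

text \<open>
  The quotient \<open>expK_coeff n / wallis_coeff n\<close> equals \<open>pi / 4\<close> at \<open>n = 1\<close> and grows as long as the gaps are
  nonnegative.
\<close>
lemma expK_coeff_ge_wallis:
  assumes "n > 0" and "\<And>i. 0 < i \<Longrightarrow> i < n \<Longrightarrow> ratio_gap i \<ge> 0"
  shows "expK_coeff n \<ge> pi / 4 * wallis_coeff n"
proof -
  have "n \<ge> 1" using assms by simp
  then show ?thesis
    using assms(2)
  proof (induction n rule: dec_induct)
    case base
    show ?case using expK_coeff_1 by (simp add: wallis_coeff_Suc)
  next
    case (step n)
    have "2 * (real n + 1) * (pi / 4 * wallis_coeff (Suc n))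
        = (2 * real n + 1) * (pi / 4 * wallis_coeff n)"
      by (simp add: wallis_coeff_Suc divide_simps) (simp add: algebra_simps)
    also have "\<dots> \<le> (2 * real n + 1) * expK_coeff n + ratio_gap n"
      using step by (intro add_increasing2 mult_left_mono) auto
    also have "\<dots> = 2 * (real n + 1) * expK_coeff (Suc n)"
      by (rule expK_coeff_Suc_eq[symmetric])
    finally show ?case
      by (simp add: mult_le_cancel_left_pos)
  qed
qed

text \<open>
  Nonnegative gaps make \<open>i * expK_coeff i\<close> nondecreasing, so \<open>expK_coeff (n - i)\<close> is at most
  \<open>n / (n - i) * expK_coeff n\<close> for \<open>0 < i < n\<close>. Together with \<open>wallis_step i \<le> 1 / (4 i (i + 1))\<close> and partial
  fractions this bounds the convolution for \<open>ratio_gap n\<close>. The summand \<open>i = n\<close> contains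
  \<open>expK_coeff 0 = 1\<close>, which is out of proportion, and is compared with \<open>wallis_coeff n\<close> instead.
\<close>
lemma ratio_gap_le_quarter:
  assumes n: "n > 0" and gap_nonneg: "\<And>i. 0 < i \<Longrightarrow> i < n \<Longrightarrow> ratio_gap i \<ge> 0"
  shows "ratio_gap n \<le> expK_coeff n / 4"
proof (cases "n = 1")
  case True
  have "pi * pi \<le> 4 * pi" using pi_less_4 by (intro mult_right_mono) auto
  then have "ratio_gap 1 \<le> expK_coeff 1 / 4"
    unfolding ratio_gap_1 expK_coeff_1 right_diff_distrib by linarith
  with True show ?thesis by simp
next
  case False
  with n have n2: "n \<ge> 2" by simp
  have ratio: "expK_coeff (n - i) \<le> real n / (real n - real i) * expK_coeff n" if "i < n" for i
    using that
  proof (induction i)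
    case (Suc i)
    define k where "k = n - Suc i"
    have k: "n - i = Suc k" "0 < k" "k < n" "real n - real i = real k + 1" "real n - real (Suc i)
        = real k"
      using Suc.prems by (auto simp: k_def)
    have "2 * (real k + 1) * expK_coeff (Suc k) \<ge> 2 * real k * expK_coeff k"
      using gap_nonneg[of k] k expK_coeff_pos[of k] expK_coeff_Suc_eq[of k] by
          (simp add: algebra_simps)
    then have "expK_coeff k \<le> (real k + 1) / real k * expK_coeff (Suc k)"
      using k by (simp add: field_simps)
    also have "\<dots> \<le> (real k + 1) / real k * (real n / (real k + 1) * expK_coeff n)"
      using Suc k by (intro mult_left_mono) auto
    also have "\<dots> = real n / real k * expK_coeff n"
      by simp
    finally show ?case
      using k by (simp add: k_def)
  qed simp
  have wallis_n: "wallis_coeff n \<le> 3 / 8"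
  proof -
    have "wallis_coeff n \<le> wallis_coeff 2"
      using n2 by (intro decseqD[OF decseq_wallis_coeff])
    then show ?thesis by (simp add: wallis_coeff_Suc numeral_2_eq_2)
  qed
  have step_n: "wallis_step n \<le> expK_coeff n * (3 / (8 * (real n + 1)))"
  proof -
    have "wallis_step n = (pi / 4 * wallis_coeff n) * (wallis_coeff n / (real n + 1))"
      by (simp add: wallis_step_def power2_eq_square)
    also have "\<dots> \<le> expK_coeff n * ((3/8) / (real n + 1))"
      using expK_coeff_ge_wallis[OF assms] wallis_n wallis_coeff_pos[of n] n2 expK_coeff_pos[of n]
      by (intro mult_mono divide_right_mono) (auto simp: field_simps)
    finally show ?thesis by simp
  qed
  \<comment> \<open>partial fractions: \<open>n / (i * (n - i)) = 1 / i + 1 / (n - i)\<close>\<close>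
  have term_le: "wallis_step i * expK_coeff (n - i)
      \<le> expK_coeff n / 4 * (1 / (real i * (real i + 1)) + 1 / ((real n - real i) * (real i + 1)))"
    if "i \<in> {1..<n}" for i
  proof -
    have "wallis_step i * expK_coeff (n - i)
        \<le> 1 / (4 * real i * (real i + 1)) * (real n / (real n - real i) * expK_coeff n)"
      using that ratio[of i] wallis_step_le[of i] expK_coeff_pos[of "n - i"]
      by (intro mult_mono) auto
    also have "\<dots> = expK_coeff n / 4
        * (1 / (real i * (real i + 1)) + 1 / ((real n - real i) * (real i + 1)))"
      using that by (simp add: divide_simps)
    finally show ?thesis .
  qed
  have split: "ratio_gap n = (pi / 4 - 1) * expK_coeff n
      + (\<Sum>i=1..<n. wallis_step i * expK_coeff (n - i)) + wallis_step n"
  proof -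
    have "{0..n} = insert 0 (insert n {1..<n})"
      using n2 by auto
    then show ?thesis
      using n2 by (simp add: ratio_gap_conv gap_factor_def wallis_step_0)
  qed
  have middle: "(\<Sum>i=1..<n. wallis_step i * expK_coeff (n - i)) \<le>
      expK_coeff n / 4 * (1 - 1 / real n + (1 / n + (real n - 2) / (2 * (real n - 1))))"
  proof -
    have "(\<Sum>i=1..<n. wallis_step i * expK_coeff (n - i)) \<le>
       (\<Sum>i=1..<n. expK_coeff n / 4 * (1 / (real i * (real i + 1)) + 1 / ((real n - real i) *
         (real i + 1))))"
      using term_le by (rule sum_mono)
    also have "\<dots> = expK_coeff n / 4
        * ((\<Sum>i=1..<n. 1 / (real i * (real i + 1))) + (\<Sum>i=1..<n. 1 / ((real n - real i) * (real i
            + 1))))"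
      unfolding sum_distrib_left[symmetric] sum.distrib ..
    also have "(\<Sum>i=1..<n. 1 / (real i * (real i + 1))) = 1 - 1 / real n"
      using sum_inverse_consecutive[of "n - 1"] n2 by (simp add: of_nat_diff)
    finally show ?thesis
      using sum_inverse_opposite_le[OF n2] expK_coeff_pos[of n]
      by (elim order_trans) (intro mult_left_mono add_left_mono, auto)
  qed
  have "ratio_gap n \<le> (pi / 4 - 1) * expK_coeff n + expK_coeff n / 4
      * (1 - 1 / real n + (1 / n + (real n - 2) / (2 * (real n - 1))))
     + expK_coeff n * (3 / (8 * (real n + 1)))"
    using split middle step_n by linarith
  also have "(pi / 4 - 1) * expK_coeff n + expK_coeff n / 4
      * (1 - 1 / real n + (1 / n + (real n - 2) / (2 * (real n - 1))))
     + expK_coeff n * (3 / (8 * (real n + 1))) =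
     expK_coeff n * (pi / 4 - 3 / 4 + (real n - 2) / (8 * (real n - 1)) + 3 / (8 * (real n + 1)))"
    by (simp add: algebra_simps)
  also have "\<dots> \<le> expK_coeff n * (1 / 4)"
  proof (intro mult_left_mono)
    have n_sq: "real n ^ 2 > 1" using n2 by (intro one_less_power) auto
    have "(real n - 2) / (8 * (real n - 1)) + 3 / (8 * (real n + 1))
        = 1 / 8 + (2 * real n - 4) / (8 * (real n ^ 2 - 1))"
      using n2 n_sq by (simp add: divide_simps power2_eq_square) (simp add: algebra_simps)
    also have "(2 * real n - 4) / (8 * (real n ^ 2 - 1)) \<le> 7 / 80"
    proof -
      have "0 \<le> (7 * real n - 10)\<^sup>2" by simp
      with n_sq show ?thesis by (simp add: divide_simps power2_eq_square algebra_simps)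
    qed
    finally show "pi / 4 - 3 / 4 + (real n - 2) / (8 * (real n - 1)) + 3 / (8 * (real n + 1))
        \<le> 1 / 4"
      using pi_bounds by linarith
  qed (use expK_coeff_pos[of n] in simp)
  finally show ?thesis by simp
qed

text \<open>
  A gap of at most a quarter of \<open>expK_coeff n\<close> turns the ratio \<open>(2 n + 1) / (2 n + 2)\<close> of the Wallis
  coefficients into at most \<open>(2 n + 5 / 4) / (2 n + 2)\<close>, which still is a definite decrease.
\<close>
lemma expK_coeff_drop:
  assumes n: "n > 0" and gap_nonneg: "\<And>i. 0 < i \<Longrightarrow> i < n \<Longrightarrow> ratio_gap i \<ge> 0"
  shows "expK_coeff n - expK_coeff (Suc n) \<ge> 3 / 8 * expK_coeff (Suc n) / (real n + 1)"
proof -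
  have le: "2 * (real n + 1) * expK_coeff (Suc n) \<le> (2 * real n + 5 / 4) * expK_coeff n"
    using ratio_gap_le_quarter[OF assms] unfolding expK_coeff_Suc_eq by (simp add: algebra_simps)
  moreover have "(2 * real n + 5 / 4) * expK_coeff n \<le> 2 * (real n + 1) * expK_coeff n"
    using expK_coeff_pos[of n] by (intro mult_right_mono) auto
  ultimately have "2 * (real n + 1) * expK_coeff (Suc n) \<le> 2 * (real n + 1) * expK_coeff n"
    by linarith
  then have "expK_coeff (Suc n) \<le> expK_coeff n"
    by (simp add: mult_le_cancel_left_pos)
  with le have "(real n + 1) * (expK_coeff n - expK_coeff (Suc n)) \<ge> 3 / 8 * expK_coeff (Suc n)"
    by (simp add: algebra_simps)
  then show ?thesis
    by (simp add: field_simps)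
qed

text \<open>
  The sequence \<open>n * (wallis_coeff n)\<^sup>2\<close> increases from its value \<open>1 / 4\<close> at \<open>n = 1\<close>.
\<close>
lemma wallis_coeff_ge_sqrt:
  assumes "n > 0"
  shows "wallis_coeff n \<ge> 1 / (2 * sqrt n)"
proof -
  have "wallis_ratio 1 \<le> wallis_ratio n"
    using assms by (intro monoD[OF mono_wallis_ratio]) simp
  then have "1 / 4 \<le> n * (wallis_coeff n)\<^sup>2"
    by (simp add: wallis_ratio_def wallis_coeff_Suc power2_eq_square)
  then have "(1 / (2 * sqrt n))\<^sup>2 \<le> (wallis_coeff n)\<^sup>2"
    using assms by (simp add: power_divide power_mult_distrib field_simps)
  then show ?thesis
    using wallis_coeff_pos[of n] by (meson less_imp_le power2_le_imp_le)
qed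

text \<open>
  This is the induction step of \<open>ratio_gap_pos\<close> multiplied by \<open>4 n (n + 1)\<close>, with \<open>U = expK_coeff n\<close>
  and \<open>x = wallis_ratio n\<close>. The first summand changes sign from negative to positive between \<open>n = 9\<close> and
  \<open>n = 10\<close>, the second one from positive to negative between \<open>n = 18\<close> and \<open>n = 19\<close>. Before the first
  change the upper bound for \<open>U\<close> is used, after the second one the lower bound.
\<close>
lemma source_balance:
  assumes n: "n \<ge> 2" and U: "0 < U" "U \<le> 1 / 3" "U \<ge> pi / (8 * sqrt n)" and x: "7 / 8 \<le> x" "x \<le> 1"
  shows "U * (9 * pi / 128 * (real n + 1) - 9 / 4) + x * (9 / (2 * (real n + 2)) - (1 - pi / 4))
      \<ge> 0"
proof -
  note pi = pi_bounds
  define t where "t = 9 * pi / 128 * (real n + 1) - 9 / 4"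
  define w where "w = 9 / (2 * (real n + 2)) - (1 - pi / 4)"
  have t_ge: "t \<ge> 11 / 50 * (real n + 1) - 9 / 4"
  proof -
    have "9 * pi / 128 * (real n + 1) \<ge> 11 / 50 * (real n + 1)"
      using pi by (intro mult_right_mono) auto
    then show ?thesis by (simp add: t_def)
  qed
  define y where "y = 9 / 2 / (real n + 2)"
  have w_ge: "w \<ge> y - 43 / 200"
    using pi by (simp add: w_def y_def)
  consider "n \<le> 9" | "10 \<le> n" "n \<le> 18" | "19 \<le> n" "n \<le> 21" | "22 \<le> n" by linarith
  then have "U * t + x * w \<ge> 0"
  proof cases
    case 1
    have "y \<ge> 9 / 2 / 11"
      unfolding y_def using 1 by (intro divide_left_mono) auto
    then have w: "x * w \<ge> 7 / 8 * (y - 43 / 200)"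
      using w_ge x by (intro mult_mono) auto
    have "U * t \<ge> U * (11 / 50 * (real n + 1) - 9 / 4)"
      using t_ge U by (intro mult_left_mono) auto
    moreover have "U * (11 / 50 * (real n + 1) - 9 / 4) \<ge> 1 / 3 * (11 / 50 * (real n + 1) - 9 / 4)"
      using 1 U by (intro mult_right_mono_neg) auto
    moreover have "1 / 3 * (11 / 50 * (real n + 1) - 9 / 4) + 7 / 8 * (y - 43 / 200) \<ge> 0"
    proof -
      \<comment> \<open>After multiplication by \<open>r\<close> the claim is a quadratic inequality in \<open>r\<close>; completing the square
        at the integer \<open>7\<close> next to the vertex leaves positive remainders.\<close>
      define r where "r = real n + 2"
      have r: "r > 0" by (simp add: r_def)
      have "0 \<le> 11 / 50 / 3 * (r - 7)\<^sup>2 + 7 / 8 * (9 / 2) - 11 / 50 / 3 * 49 + r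
          * (11 / 50 / 3 * 14 - (247 / 100 / 3 + 7 / 8 * (43 / 200)))"
        using r by simp
      also have "\<dots> = r * (1 / 3 * (11 / 50 * (r - 1) - 9 / 4) + 7 / 8 * (9 / 2 / r - 43 / 200))"
        using r by (simp add: power2_eq_square field_simps)
      finally show ?thesis
        using r by (simp add: zero_le_mult_iff r_def y_def add_ac)
    qed
    ultimately show ?thesis using w by linarith
  next
    case 2
    have "y \<ge> 9 / 2 / 20"
      unfolding y_def using 2 by (intro divide_left_mono) auto
    then have "w \<ge> 0" using w_ge by linarith
    moreover have "t \<ge> 0"
    proof -
      have "real n \<ge> 10" using 2 by simp
      with t_ge show ?thesis by (simp add: field_simps)
    qed
    ultimately show ?thesis using U x by simp
  next
    case 3
    have "y \<ge> 9 / 2 / 23"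
      unfolding y_def using 3 by (intro divide_left_mono) auto
    then have "w \<ge> - (1 / 50)" using w_ge by linarith
    then have "x * w \<ge> x * (- (1 / 50))"
      using x by (intro mult_left_mono) auto
    then have "x * w \<ge> - (1 / 50)" using x by linarith
    moreover have "U * t \<ge> 1 / 20 * 2"
    proof (rule mult_mono)
      have "sqrt (real n) \<le> sqrt (5 ^ 2)" using 3 by (intro real_sqrt_le_mono) auto
      then have "pi / (8 * sqrt n) \<ge> 157 / 50 / (8 * 5)"
        using pi 3 by (intro frac_le) auto
      then show "1 / 20 \<le> U" using U by linarith
      have "real n \<ge> 19" using 3 by simp
      with t_ge show "2 \<le> t" by (simp add: field_simps)
    qed (use U in auto)
    ultimately show ?thesis by linarith
  next
    case 4
    have "0 < y" by (simp add: y_def)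
    then have "w \<ge> - (43 / 200)" using w_ge by linarith
    then have "x * w \<ge> x * (- (43 / 200))"
      using x by (intro mult_left_mono) auto
    then have "x * w \<ge> - (43 / 200)" using x by linarith
    moreover have "U * t \<ge> 43 / 200"
    proof -
      define s where "s = sqrt n"
      have s: "s > 0" "s ^ 2 = n" using 4 by (auto simp: s_def)
      have s_ge: "s \<ge> 469 / 100"
        unfolding s_def using 4 by (intro real_le_rsqrt) (simp add: power2_eq_square)
      have "t \<ge> 11 / 50 * s ^ 2 - 203 / 100" using t_ge s by (simp add: field_simps)
      moreover have "11 / 50 * s ^ 2 - 203 / 100 \<ge> 2739 / 5000 * s"
      proof -
        have "(s - 469 / 100) * (11 / 50 * s + 121 / 250) \<ge> 0"
          using s_ge by (intro mult_nonneg_nonneg) auto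
        then show ?thesis using s_ge by (simp add: power2_eq_square algebra_simps)
      qed
      ultimately have "t \<ge> 2739 / 5000 * s" by linarith
      then have "U * t \<ge> 157 / 50 / (8 * s) * (2739 / 5000 * s)"
      proof (intro mult_mono)
        have "pi / (8 * s) \<ge> 157 / 50 / (8 * s)"
          using pi s by (intro divide_right_mono) auto
        then show "157 / 50 / (8 * s) \<le> U" using U(3) unfolding s_def by linarith
      qed (use s U in auto)
      then show ?thesis using s by (simp add: field_simps)
    qed
    ultimately show ?thesis by linarith
  qed
  then show ?thesis by (simp add: t_def w_def)
qed

text \<open>
  Strong induction along \<open>ratio_gap_rec\<close>. The sum with \<open>gap_factor\<close> has only two negative terms: the
  constant coefficient of \<open>q\<close> times the current gap, which the factor \<open>2 n - 1\<close> absorbs, and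
  \<open>wallis_step n\<close> times the negative gap at \<open>0\<close>, which the sum with \<open>gap_source\<close> has to compensate.
\<close>
lemma ratio_gap_pos: "n > 0 \<Longrightarrow> ratio_gap n > 0"
proof (induction n rule: less_induct)
  case (less N)
  show ?case
  proof (cases "N = 1")
    case True
    have "pi / 32 * (pi - 3) > 0"
      using pi_gt3 by (intro mult_pos_pos) auto
    with True ratio_gap_1 show ?thesis by simp
  next
    case False
    with less.prems obtain n where N: "N = Suc n" and n: "n > 0"
      by (cases N) auto
    have gap: "ratio_gap i > 0" if "0 < i" "i \<le> n" for i
      using less.IH that N by simp
    have gap_nonneg: "ratio_gap i \<ge> 0" if "0 < i" "i \<le> n" for i
      using gap[OF that] by simp
    let ?t = "1 - pi / 4"
    have drop: "expK_coeff i - expK_coeff (Suc i) \<ge> 3 / 8 * expK_coeff (Suc i) / (real i + 1)"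
        if "0 < i" "i \<le> n" for i
      using that gap_nonneg by (intro expK_coeff_drop) auto
    have anti: "expK_coeff (Suc i) \<le> expK_coeff i" if "i \<le> n" for i
    proof (cases "i = 0")
      case True
      then show ?thesis using expK_coeff_1 pi_less_4 by simp
    next
      case False
      have "0 \<le> 3 / 8 * expK_coeff (Suc i) / (real i + 1)"
        using expK_coeff_pos[of "Suc i"] by simp
      with drop[of i] that False show ?thesis by simp
    qed
    have anti': "expK_coeff n \<le> expK_coeff (n - i)" if "i \<le> n" for i
      using that
    proof (induction i)
      case (Suc i)
      with anti[of "n - Suc i"] show ?case by (simp add: Suc_diff_Suc)
    qed simp
    have gap_part: "(\<Sum>i=0..n. gap_factor i * ratio_gap (n - i))
        \<ge> - (?t * ratio_gap n) - ?t * wallis_step n"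
    proof -
      have "(\<Sum>i\<in>{1..<n}. gap_factor i * ratio_gap (n - i)) \<ge> 0"
        using gap_nonneg wallis_step_nonneg by (intro sum_nonneg mult_nonneg_nonneg)
            (auto simp: gap_factor_def)
      moreover have "{0..n} = insert 0 (insert n {1..<n})" by auto
      ultimately show ?thesis
        using n by (simp add: gap_factor_def wallis_step_0 ratio_gap_0 algebra_simps del:
            One_nat_def)
    qed
    \<comment> \<open>Only the terms \<open>i = 1\<close> and \<open>i = n\<close> of the convolution are kept. For \<open>n = 1\<close> they coincide, so this
      case is computed exactly; it holds because \<open>pi > 3\<close>.\<close>
    have source_part: "(\<Sum>i=0..n. gap_source i * expK_coeff (n - i)) \<ge> ?t * wallis_step n"
    proof (cases "n = 1")
      case True
      have "(\<Sum>i=0..1. gap_source i * expK_coeff (1 - i))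
          = gap_source 0 * expK_coeff 1 + gap_source 1"
        by simp
      also have "\<dots> - ?t * wallis_step 1 = pi / 32 * (5 / 2 * (pi - 3))"
        unfolding gap_source_def wallis_step_0 wallis_step_1 expK_coeff_1 by (simp add: field_simps)
      also have "\<dots> \<ge> 0"
        using pi_gt3 by (intro mult_nonneg_nonneg) auto
      finally show ?thesis using True by simp
    next
      case False
      with n have n2: "n \<ge> 2" by simp
      \<comment> \<open>Subtracting \<open>expK_coeff n\<close> from every factor makes all summands nonnegative; the price is a
        partial sum of \<open>gap_source\<close>, which is only as large as the tail.\<close>
      have "(\<Sum>i=0..n. gap_source i * expK_coeff (n - i))
          = (\<Sum>i=0..n. gap_source i * (expK_coeff (n - i) - expK_coeff n)) + (\<Sum>i=0..n. gap_source
            i) * expK_coeff n"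
        by (simp add: sum_distrib_right right_diff_distrib sum_subtractf)
      moreover have "(\<Sum>i=0..n. gap_source i * (expK_coeff (n - i) - expK_coeff n))
          \<ge> gap_source 1 * (expK_coeff (n - 1) - expK_coeff n) + gap_source n * (1 - expK_coeff n)"
      proof -
        have "(\<Sum>i\<in>{1, n}. gap_source i * (expK_coeff (n - i) - expK_coeff n))
            \<le> (\<Sum>i\<in>{1..n}. gap_source i * (expK_coeff (n - i) - expK_coeff n))"
          using n anti' wallis_step_nonneg
          by (intro sum_mono2 mult_nonneg_nonneg) (auto simp: gap_source_def)
        also have "\<dots> = (\<Sum>i=0..n. gap_source i * (expK_coeff (n - i) - expK_coeff n))"
          by (intro sum.mono_neutral_left) (auto simp: not_le)
        finally show ?thesis using n2 by simp
      qed
      moreover have "(\<Sum>i=0..n. gap_source i) * expK_coeff n - gap_source n * expK_coeff n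
          \<ge> - 9 / (16 * real n * (real n + 1)) * expK_coeff n"
      proof -
        have "(\<Sum>i=0..n. gap_source i) - gap_source n \<ge> - 9 / (16 * real n * (real n + 1))"
          using n sum_gap_source_ge[of "n - 1"] by (cases n) (auto simp: add.commute)
        then show ?thesis
          using expK_coeff_pos[of n] unfolding left_diff_distrib[symmetric]
          by (intro mult_right_mono) auto
      qed
      moreover have "gap_source 1 * (expK_coeff (n - 1) - expK_coeff n)
          \<ge> 3 * pi / 64 * (3 / 8 * expK_coeff n / real n)"
      proof -
        have source_1: "gap_source 1 = 3 * pi / 64"
          using wallis_step_1 by (simp add: gap_source_def)
        have "expK_coeff (n - 1) - expK_coeff n \<ge> 3 / 8 * expK_coeff n / real n"
          using n2 drop[of "n - 1"] by (simp add: of_nat_diff)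
        then show ?thesis
          unfolding source_1 by (intro mult_left_mono) auto
      qed
      moreover have "3 * pi / 64 * (3 / 8 * expK_coeff n / real n) + gap_source n
          - 9 / (16 * real n * (real n + 1)) * expK_coeff n - ?t * wallis_step n \<ge> 0"
      proof -
        have 2: "7 / 8 \<le> wallis_ratio n"
        proof -
          have "7 / 8 \<le> wallis_ratio 2"
            using pi_approx by
                (simp add: wallis_ratio_def wallis_coeff_Suc numeral_2_eq_2 power2_eq_square)
          also have "\<dots> \<le> wallis_ratio n" using n2 by (intro monoD[OF mono_wallis_ratio])
          finally show ?thesis .
        qed
        have U: "expK_coeff n \<le> 1 / 3"
        proof -
          have "expK_coeff n \<le> expK_coeff 2" using anti'[of "n - 2"] n2 by simp
          also have "expK_coeff 2 \<le> 1 / 3"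
            using drop[of 1] n expK_coeff_1 pi_approx by (simp add: numeral_2_eq_2)
          finally show ?thesis .
        qed
        have L: "expK_coeff n \<ge> pi / (8 * sqrt n)"
        proof -
          have "pi / (8 * sqrt n) = pi / 4 * (1 / (2 * sqrt n))"
            by simp
          also have "\<dots> \<le> pi / 4 * wallis_coeff n"
            using wallis_coeff_ge_sqrt[OF n] by (intro mult_left_mono) auto
          also have "\<dots> \<le> expK_coeff n"
            using n gap_nonneg by (intro expK_coeff_ge_wallis) auto
          finally show ?thesis .
        qed
        have "3 * pi / 64 * (3 / 8 * expK_coeff n / real n) + gap_source n
            - 9 / (16 * real n * (real n + 1)) * expK_coeff n - ?t * wallis_step n =
          (expK_coeff n * (9 * pi / 128 * (real n + 1) - 9 / 4) + wallis_ratio n * (9 / (2 *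
            (real n + 2)) - (1 - pi / 4)))
            / (4 * real n * (real n + 1))"
        proof -
          have "3 * pi / 64 * (3 / 8 * expK_coeff n / real n)
              = expK_coeff n * (9 * pi / 128 * (real n + 1)) / (4 * real n * (real n + 1))"
            using n by simp
          moreover have "gap_source n
              = wallis_ratio n * (9 / (2 * (real n + 2))) / (4 * real n * (real n + 1))"
            unfolding gap_source_def wallis_step_eq_ratio[OF n] using n by (simp add: mult_ac)
          moreover have "9 / (16 * real n * (real n + 1)) * expK_coeff n
              = expK_coeff n * (9 / 4) / (4 * real n * (real n + 1))"
            by simp
          moreover have "?t * wallis_step n = wallis_ratio n * ?t / (4 * real n * (real n + 1))"
            using n by (simp add: wallis_step_eq_ratio)
          ultimately show ?thesis
            by (simp only: right_diff_distrib diff_divide_distrib add_divide_distrib)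
        qed
        also have "\<dots> \<ge> 0"
          using source_balance[OF n2 expK_coeff_pos U L 2 wallis_ratio_le_1] n by simp
        finally show ?thesis .
      qed
      ultimately show ?thesis
        by (simp add: right_diff_distrib)
    qed
    have "2 * (real n + 1) * ratio_gap (Suc n) \<ge> (2 * real n - 1 - ?t) * ratio_gap n"
      using ratio_gap_rec[of n] gap_part source_part unfolding left_diff_distrib by linarith
    moreover have "(2 * real n - 1 - ?t) * ratio_gap n > 0"
    proof (rule mult_pos_pos)
      have "real n \<ge> 1" using n by simp
      then show "2 * real n - 1 - ?t > 0" using pi_gt_zero by linarith
    qed (use gap n in auto)
    ultimately have "2 * (real n + 1) * ratio_gap (Suc n) > 0"
      by linarith
    with N show ?thesis
      by (simp add: zero_less_mult_iff)
  qed
qed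

section \<open>Power series of the elliptic integral and of its exponential\<close>

text \<open>
  The recursion of the integrals comes from the antiderivative \<open>- (sin t) ^ (2 n + 1) * cos t\<close>, which
  vanishes at both ends.
\<close>
lemma has_integral_sin_power_even:
  "((\<lambda>t. sin t ^ (2 * n)) has_integral pi / 2 * wallis_coeff n) {0..pi / 2}"
proof (induction n)
  case 0
  show ?case using has_integral_const_real[of "1::real" 0 "pi / 2"] by simp
next
  case (Suc n)
  have "((\<lambda>t. (2 * real n + 2) * sin t ^ (2 * Suc n) - (2 * real n + 1)
      * sin t ^ (2 * n)) has_integral
      (- (sin (pi / 2) ^ (2 * n + 1) * cos (pi / 2)) - - (sin 0 ^ (2 * n + 1) * cos 0))) {0..pi /
        2}"
  proof (rule fundamental_theorem_of_calculus)
    fix t :: real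
    have "((\<lambda>t. - (sin t ^ (2 * n + 1) * cos t)) has_real_derivative
        - (real (2 * n + 1) * sin t ^ (2 * n) * (cos t)\<^sup>2 - sin t ^ (2 * n + 2))) (at t within
          {0..pi / 2})"
      by (rule derivative_eq_intros refl)+ (simp add: power2_eq_square algebra_simps)
    also have "- (real (2 * n + 1) * sin t ^ (2 * n) * (cos t)\<^sup>2 - sin t ^ (2 * n + 2)) =
        (2 * real n + 2) * sin t ^ (2 * Suc n) - (2 * real n + 1) * sin t ^ (2 * n)"
    proof -
      define s where "s = sin t"
      have cos_sq: "(cos t)\<^sup>2 = 1 - s\<^sup>2" by (simp add: cos_squared_eq s_def)
      show ?thesis
        unfolding s_def[symmetric] cos_sq by (simp add: algebra_simps power2_eq_square)
    qed
    finally show "((\<lambda>t. - (sin t ^ (2 * n + 1) * cos t)) has_vector_derivative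
        (2 * real n + 2) * sin t ^ (2 * Suc n) - (2 * real n + 1) * sin t ^ (2 * n)) (at t within
          {0..pi / 2})"
      by (simp add: has_real_derivative_iff_has_vector_derivative)
  qed simp
  from has_integral_add[OF this has_integral_mult_right[OF Suc, of "2 * real n + 1"]]
  have "((\<lambda>t. (2 * real n + 2) * sin t ^ (2 * Suc n))
      has_integral (2 * real n + 1) * (pi / 2 * wallis_coeff n)) {0..pi / 2}"
    by simp
  from has_integral_mult_right[OF this, of "1 / (2 * real n + 2)"] show ?case
    by (simp add: wallis_coeff_Suc mult_ac)
qed

lemma wallis_coeff_sums:
  assumes "\<bar>x\<bar> < 1"
  shows "(\<lambda>n. wallis_coeff n * x ^ n) sums (1 / sqrt (1 - x))"
proof -
  have "(\<lambda>n. (- (1 / 2) gchoose n) * (- x) ^ n) sums (1 + - x) powr - (1 / 2)"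
    using assms by (intro gen_binomial_real) auto
  moreover have "(- (1 / 2) gchoose n) * (- x) ^ n = wallis_coeff n * x ^ n" for n
  proof -
    have "(- 1) ^ n * (- x) ^ n = x ^ n"
      by (simp flip: power_mult_distrib)
    then show ?thesis
      by (simp add: gbinomial_pochhammer wallis_coeff_def)
  qed
  moreover have "(1 + - x) powr - (1 / 2) = 1 / sqrt (1 - x)"
    using assms by (simp add: powr_minus_divide powr_half_sqrt)
  ultimately show ?thesis by simp
qed

lemma wallis_coeff_le_1: "wallis_coeff n \<le> 1"
  using decseqD[OF decseq_wallis_coeff, of 0 n] by simp

lemma summable_bounded_powser:
  fixes a :: "nat \<Rightarrow> real"
  assumes "\<And>n. \<bar>a n\<bar> \<le> B" "\<bar>x\<bar> < 1"
  shows "summable (\<lambda>n. a n * x ^ n)" "summable (\<lambda>n. \<bar>a n * x ^ n\<bar>)"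
proof -
  show "summable (\<lambda>n. \<bar>a n * x ^ n\<bar>)"
  proof (rule summable_comparison_test')
    show "summable (\<lambda>n. B * \<bar>x\<bar> ^ n)"
      using assms by (intro summable_mult summable_geometric) auto
    show "norm \<bar>a n * x ^ n\<bar> \<le> B * \<bar>x\<bar> ^ n" for n
      using assms by (auto simp: abs_mult power_abs intro!: mult_right_mono)
  qed
  then show "summable (\<lambda>n. a n * x ^ n)"
    by (rule summable_rabs_cancel)
qed

definition K_series :: "real \<Rightarrow> real" where
  "K_series x = (\<Sum>n. pi / 2 * (wallis_coeff n)\<^sup>2 * x ^ n)"

lemma wallis_coeff_sq_le_1: "(wallis_coeff n)\<^sup>2 \<le> 1"
  using wallis_coeff_le_1[of n] wallis_coeff_pos[of n] by (simp add: power_le_one)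

lemma K_series_coeff_bound: "\<bar>pi / 2 * (wallis_coeff n)\<^sup>2\<bar> \<le> pi / 2"
  using wallis_coeff_sq_le_1[of n] by (simp add: abs_mult)

text \<open>
  The integrand is a binomial series with nonnegative terms in powers of \<open>sin t\<close>, so monotone
  convergence permits termwise integration.
\<close>
lemma elliptic_K_eq_K_series:
  assumes "0 \<le> x" "x < 1"
  shows "elliptic_K (sqrt x) = K_series x"
proof -
  have "((\<lambda>t. 1 / sqrt (1 - (sqrt x)\<^sup>2 * (sin t)\<^sup>2)) has_integral K_series x) {0..pi / 2}"
  proof (rule has_integral_monotone_convergence_increasing)
    show "((\<lambda>t. \<Sum>n<k. wallis_coeff n * x ^ n * sin t ^ (2 * n))
        has_integral (\<Sum>n<k. wallis_coeff n * x ^ n * (pi / 2 * wallis_coeff n))) {0..pi / 2}" for k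
      by (intro has_integral_sum has_integral_mult_right has_integral_sin_power_even) auto
    show "(\<Sum>n<k. wallis_coeff n * x ^ n * sin t ^ (2 * n))
        \<le> (\<Sum>n<Suc k. wallis_coeff n * x ^ n * sin t ^ (2 * n))" for k t
      using wallis_coeff_pos[of k] assms by (simp add: power_mult)
    show "(\<lambda>k. \<Sum>n<k. wallis_coeff n * x ^ n * sin t ^ (2 * n)) \<longlonglongrightarrow> 1 / sqrt (1 - (sqrt x)\<^sup>2
        * (sin t)\<^sup>2)" for t
    proof -
      have "x * (sin t)\<^sup>2 \<le> x * 1"
        using assms by (intro mult_left_mono) (auto simp: abs_square_le_1)
      then have "(\<lambda>n. wallis_coeff n * (x * (sin t)\<^sup>2) ^ n) sums (1 / sqrt (1 - x * (sin t)\<^sup>2))"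
        using assms by (intro wallis_coeff_sums) auto
      then show ?thesis
        using assms by (simp add: sums_def power_mult_distrib mult_ac flip: power_mult)
    qed
    have "(\<lambda>n. pi / 2 * (wallis_coeff n)\<^sup>2 * x ^ n) sums K_series x"
      unfolding K_series_def using assms
      by (intro summable_sums summable_bounded_powser[OF K_series_coeff_bound]) auto
    then show "(\<lambda>k. \<Sum>n<k. wallis_coeff n * x ^ n * (pi / 2 * wallis_coeff n)) \<longlonglongrightarrow> K_series x"
      by (simp add: sums_def power2_eq_square mult_ac)
  qed
  then show ?thesis
    unfolding elliptic_K_def by (rule integral_unique)
qed

lemma K_series_0: "K_series 0 = pi / 2"
  unfolding K_series_def by (subst powser_zero) simp

lemma abs_wallis_ratio_le_1: "\<bar>wallis_ratio n\<bar> \<le> 1"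
  using wallis_ratio_le_1[of n] by (simp add: wallis_ratio_def)

lemma K_series_deriv:
  assumes "\<bar>x\<bar> < 1"
  shows "(K_series has_real_derivative (\<Sum>n. wallis_ratio (Suc n) * x ^ n) / 2) (at x)"
proof -
  have "((\<lambda>x. \<Sum>n. pi / 2 * (wallis_coeff n)\<^sup>2 * x ^ n)
      has_real_derivative (\<Sum>n. diffs (\<lambda>n. pi / 2 * (wallis_coeff n)\<^sup>2) n * x ^ n)) (at x)"
    using assms by (intro termdiffs_strong'[of 1] summable_bounded_powser[OF
        K_series_coeff_bound]) auto
  also have "(\<lambda>x. \<Sum>n. pi / 2 * (wallis_coeff n)\<^sup>2 * x ^ n) = K_series"
    by (simp add: K_series_def fun_eq_iff)
  also have "(\<Sum>n. diffs (\<lambda>n. pi / 2 * (wallis_coeff n)\<^sup>2) n * x ^ n)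
      = (\<Sum>n. (wallis_ratio (Suc n) * x ^ n) / 2)"
    by (simp add: diffs_def wallis_ratio_def mult_ac)
  also have "\<dots> = (\<Sum>n. wallis_ratio (Suc n) * x ^ n) / 2"
    using assms abs_wallis_ratio_le_1
    by (intro suminf_divide summable_bounded_powser[where B = 1]) auto
  finally show ?thesis .
qed

lemma abs_expK_coeff_le_1: "\<bar>expK_coeff n\<bar> \<le> 1"
  using expK_coeff_le_1[of n] expK_coeff_pos[of n] by simp

text \<open>
  The series \<open>F\<close> with the coefficients \<open>expK_coeff\<close> solves \<open>F' = K' F\<close>, by the Cauchy product; hence
  \<open>F exp (- K)\<close> is constant.
\<close>
lemma exp_K_series_sums:
  assumes x: "\<bar>x\<bar> < 1"
  shows "(\<lambda>n. exp (pi / 2) * expK_coeff n * x ^ n) sums exp (K_series x)"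
proof -
  define F where "F = (\<lambda>x. \<Sum>n. expK_coeff n * x ^ n)"
  have F_deriv: "(F has_real_derivative (\<Sum>n. wallis_ratio (Suc n) * y ^ n) / 2
      * F y) (at y)" if y: "\<bar>y\<bar> < 1" for y
  proof -
    have F: "(F has_real_derivative (\<Sum>n. diffs expK_coeff n * y ^ n)) (at y)"
      unfolding F_def using y abs_expK_coeff_le_1
      by (intro termdiffs_strong'[of 1] summable_bounded_powser[where B = 1]) auto
    have "(\<lambda>n. 2 * (diffs expK_coeff n * y ^ n)) sums ((\<Sum>n. wallis_ratio (Suc n) * y ^ n) * F y)"
    proof -
      have "(\<lambda>n. \<Sum>i\<le>n. (wallis_ratio (Suc i) * y ^ i) * (expK_coeff (n - i) * y ^ (n - i)))
          sums ((\<Sum>n. wallis_ratio (Suc n) * y ^ n) * F y)"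
        unfolding F_def real_norm_def using y abs_wallis_ratio_le_1 abs_expK_coeff_le_1
        by (intro Cauchy_product_sums; simp only: real_norm_def) (intro
            summable_bounded_powser[where B = 1]; simp)+
      moreover have "(\<Sum>i\<le>n. (wallis_ratio (Suc i) * y ^ i) * (expK_coeff (n - i) * y ^ (n - i)))
          = 2 * (diffs expK_coeff n * y ^ n)" for n
      proof -
        have "(\<Sum>i\<le>n. (wallis_ratio (Suc i) * y ^ i) * (expK_coeff (n - i) * y ^ (n - i)))
            = (\<Sum>i\<le>n. wallis_ratio (Suc i) * expK_coeff (n - i) * y ^ n)"
          by (intro sum.cong) (auto simp: mult_ac simp flip: power_add)
        also have "\<dots> = 2 * (real n + 1) * expK_coeff (Suc n) * y ^ n"
          by (simp add: expK_coeff.simps(2) sum_distrib_right[symmetric] atMost_atLeast0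
              divide_simps)
        finally show ?thesis
          by (simp add: diffs_def mult_ac)
      qed
      ultimately show ?thesis by simp
    qed
    then have "(\<lambda>n. diffs expK_coeff n * y ^ n) sums ((\<Sum>n. wallis_ratio (Suc n) * y ^ n) / 2 * F y)"
      using sums_mult_iff[of 2 "\<lambda>n. diffs expK_coeff n
          * y ^ n" "(\<Sum>n. wallis_ratio (Suc n) * y ^ n) / 2 * F y"] by simp
    from sums_unique[OF this] F show ?thesis
      by (simp only:)
  qed
  have "F x * exp (- K_series x) = F 0 * exp (- K_series 0)"
  proof (rule DERIV_isconst3[where f = "\<lambda>x. F x * exp (- K_series x)" and a = "-1" and b = 1])
    fix y :: real assume "y \<in> {-1<..<1}"
    then have y: "\<bar>y\<bar> < 1" by auto
    show "((\<lambda>x. F x * exp (- K_series x)) has_real_derivative 0) (at y)"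
      by (rule derivative_eq_intros F_deriv[OF y] K_series_deriv[OF y] refl)+
          (simp add: algebra_simps)
  qed (use x in auto)
  also have "F 0 = 1"
    unfolding F_def by (subst powser_zero) simp
  finally have "exp (K_series x) = exp (pi / 2) * F x"
    by (simp add: K_series_0 exp_minus field_simps)
  moreover have "(\<lambda>n. exp (pi / 2) * (expK_coeff n * x ^ n)) sums (exp (pi / 2) * F x)"
    unfolding F_def using x abs_expK_coeff_le_1
    by (intro sums_mult summable_sums summable_bounded_powser[where B = 1]) auto
  ultimately show ?thesis
    by (simp add: mult_ac)
qed

section \<open>Behaviour at the logarithmic singularity\<close>

text \<open>
  Let \<open>s t\<close> be the square root in the integrand and split \<open>1 = sin t + (1 - sin t)\<close> in the numerator. The
  first part carries the singularity and has an elementary antiderivative. For the second part put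
  \<open>\<theta> = pi / 4 - t / 2\<close>, so that \<open>1 - sin t = tan \<theta> * cos t\<close>. The bounds \<open>r cos t \<le> s t \<le> cos t + r'\<close> then
  enclose it between \<open>tan \<theta> - r'\<close> and \<open>tan \<theta> / r\<close>, and \<open>tan \<theta>\<close> has the integral \<open>ln 2\<close>. Both
  bounds are \<open>ln (4 / r') + o(1)\<close> as \<open>r\<close> tends to \<open>1\<close>, and the upper one is even \<open>ln (4 / r') + o(r')\<close>.
\<close>
lemma elliptic_K_bounds:
  assumes r: "0 < r" "r < 1"
  defines "r' \<equiv> sqrt (1 - r\<^sup>2)"
  shows "elliptic_K r \<le> ln (4 / r') / r"
    and "elliptic_K r \<ge> ln (2 * (1 + r) / r') - pi / 2 * r'"
proof -
  have r2: "0 < r\<^sup>2" "r\<^sup>2 < 1"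
    using r by (auto simp: power_less_one_iff abs_square_less_1)
  have r': "0 < r'" "r' < 1" "r'\<^sup>2 = 1 - r\<^sup>2"
    using r2 by (auto simp: r'_def)
  define s where "s t = sqrt (1 - r\<^sup>2 * (sin t)\<^sup>2)" for t :: real
  have "r\<^sup>2 * (sin t)\<^sup>2 < 1" for t
  proof -
    have "r\<^sup>2 * (sin t)\<^sup>2 \<le> r\<^sup>2 * 1"
      by (intro mult_left_mono) (auto simp: abs_square_le_1)
    with r2 show ?thesis by linarith
  qed
  then have s_pos: "s t > 0" and s_sq: "(s t)\<^sup>2 = 1 - r\<^sup>2 * (sin t)\<^sup>2" for t
    by (simp_all add: s_def less_imp_le)
  have s_cos: "(s t)\<^sup>2 = (r * cos t)\<^sup>2 + r'\<^sup>2" for t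
    by (simp add: s_sq r' power_mult_distrib cos_squared_eq algebra_simps)
  define \<theta> where "\<theta> t = pi / 4 - t / 2" for t :: real
  have tan_cos: "tan (\<theta> t) * cos t = 1 - sin t" and cos_pos: "cos (\<theta> t) > 0"
    and tan_nonneg: "tan (\<theta> t) \<ge> 0" and tan_le: "tan (\<theta> t) \<le> cos t" 
    if t: "t \<in> {0..pi / 2}" for t
  proof -
    have \<theta>: "0 \<le> \<theta> t" "\<theta> t \<le> pi / 4" using t by (auto simp: \<theta>_def)
    then show pos: "cos (\<theta> t) > 0"
      using pi_gt_zero by (intro cos_gt_zero_pi) linarith+
    have t_eq: "t = pi / 2 - 2 * \<theta> t" by (simp add: \<theta>_def)
    have cos_t: "cos t = sin (2 * \<theta> t)" and sin_t: "sin t = cos (2 * \<theta> t)"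
      by (subst t_eq, simp add: cos_diff sin_diff)+
    show eq: "tan (\<theta> t) * cos t = 1 - sin t"
      unfolding cos_t sin_t using pos
      by (simp add: tan_def sin_double cos_double_sin power2_eq_square)
    show nonneg: "tan (\<theta> t) \<ge> 0"
      using \<theta> pi_gt_zero by (intro tan_pos_pi2_le) linarith+
    have "tan (\<theta> t) * 1 \<le> tan (\<theta> t) * (2 * (cos (\<theta> t))\<^sup>2)"
    proof (rule mult_left_mono)
      have "0 \<le> cos (2 * \<theta> t)" using \<theta> by (intro cos_ge_zero) auto
      then show "1 \<le> 2 * (cos (\<theta> t))\<^sup>2" by (simp add: cos_double_cos)
    qed (rule nonneg)
    also have "\<dots> = cos t"
      unfolding cos_t using pos by (simp add: tan_def sin_double power2_eq_square)
    finally show "tan (\<theta> t) \<le> cos t" by simp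
  qed
  have sin_part: "((\<lambda>t. sin t / s t) has_integral ln ((1 + r) / r') / r) {0..pi / 2}"
  proof -
    have "((\<lambda>t. sin t / s t) has_integral (- (ln (r * cos (pi / 2) + s (pi / 2)) / r)
        - - (ln (r * cos 0 + s 0) / r))) {0..pi / 2}"
    proof (rule fundamental_theorem_of_calculus)
      fix t :: real assume t: "t \<in> {0..pi / 2}"
      have "cos t \<ge> 0" using t by (intro cos_ge_zero) auto
      with r s_pos[of t] have pos: "r * cos t + s t > 0"
        by (intro add_nonneg_pos mult_nonneg_nonneg) auto
      have s_deriv: "(s has_real_derivative
          - (r\<^sup>2 * sin t * cos t) / s t) (at t within {0..pi / 2})"
        unfolding s_def using s_pos[of t]
        by (auto intro!: derivative_eq_intros simp: s_def field_simps)
      have "((\<lambda>t. r * cos t + s t)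
          has_real_derivative - (r * sin t / s t) * (r * cos t + s t)) (at t within {0..pi / 2})"
        using s_pos[of t]
        by (auto intro!: derivative_eq_intros s_deriv simp: field_simps power2_eq_square)
      from DERIV_minus[OF DERIV_cdivide[OF DERIV_chain2[OF DERIV_ln_divide[OF pos] this]], of r]
      have "((\<lambda>t. - (ln (r * cos t + s t) / r)) has_real_derivative
          - (1 / (r * cos t + s t) * (- (r * sin t / s t) * (r * cos t + s t)) / r)) (at t within
            {0..pi / 2})" .
      also have "- (1 / (r * cos t + s t) * (- (r * sin t / s t) * (r * cos t + s t)) / r)
          = sin t / s t"
        using pos r by simp
      finally show "((\<lambda>t. - (ln (r * cos t + s t) / r))
          has_vector_derivative sin t / s t) (at t within {0..pi / 2})"
        by (simp add: has_real_derivative_iff_has_vector_derivative)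
    qed simp
    moreover have "- (ln (r * cos (pi / 2) + s (pi / 2)) / r) - - (ln (r * cos 0 + s 0) / r)
        = ln ((1 + r) / r') / r"
      using r r' by (simp add: s_def r'_def ln_div field_simps)
    ultimately show ?thesis by simp
  qed
  have tan_part: "((\<lambda>t. tan (\<theta> t)) has_integral ln 2) {0..pi / 2}"
  proof -
    have "((\<lambda>t. tan (\<theta> t)) has_integral (2 * ln (cos (\<theta> (pi / 2))) - 2
        * ln (cos (\<theta> 0)))) {0..pi / 2}"
    proof (rule fundamental_theorem_of_calculus)
      fix t :: real assume t: "t \<in> {0..pi / 2}"
      have "((\<lambda>t. 2 * ln (cos (\<theta> t))) has_real_derivative tan (\<theta> t)) (at t within {0..pi / 2})"
        using cos_pos[OF t] unfolding \<theta>_def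
        by (auto intro!: derivative_eq_intros simp: tan_def field_simps)
      then show "((\<lambda>t. 2 * ln (cos (\<theta> t)))
          has_vector_derivative tan (\<theta> t)) (at t within {0..pi / 2})"
        by (simp add: has_real_derivative_iff_has_vector_derivative)
    qed simp
    moreover have "2 * ln (cos (\<theta> (pi / 2))) - 2 * ln (cos (\<theta> 0)) = ln 2"
      by (simp add: \<theta>_def cos_45 ln_div ln_sqrt)
    ultimately show ?thesis by simp
  qed
  have K: "((\<lambda>t. 1 / s t) has_integral elliptic_K r) {0..pi / 2}"
  proof -
    have s_cont: "continuous_on {0..pi / 2} s"
      unfolding s_def by (intro continuous_intros)
    have "s t \<noteq> 0" for t
      using s_pos[of t] by simp
    then have "continuous_on {0..pi / 2} (\<lambda>t. 1 / s t)"
      by (intro continuous_on_divide continuous_on_const s_cont) simp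
    then show ?thesis
      unfolding elliptic_K_def s_def[symmetric]
      by (intro integrable_integral integrable_continuous_real)
  qed
  have ln_split: "ln (2 * (1 + r) / r') = ln ((1 + r) / r') + ln 2"
  proof -
    have "ln ((1 + r) / r' * 2) = ln ((1 + r) / r') + ln 2"
      using r r' by (intro ln_mult_pos) auto
    then show ?thesis by (simp add: mult.commute)
  qed
  show "elliptic_K r \<le> ln (4 / r') / r"
  proof -
    have "elliptic_K r \<le> ln ((1 + r) / r') / r + ln 2 / r"
    proof (rule has_integral_le[OF K has_integral_add[OF sin_part has_integral_divide[OF
        tan_part]]])
      fix t assume t: "t \<in> {0..pi / 2}"
      have "r * cos t \<le> s t"
      proof (rule power2_le_imp_le)
        show "(r * cos t)\<^sup>2 \<le> (s t)\<^sup>2" unfolding s_cos by simp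
      qed (use s_pos[of t] in simp)
      then have "tan (\<theta> t) * (r * cos t) \<le> tan (\<theta> t) * s t"
        using tan_nonneg[OF t] by (rule mult_left_mono)
      then have "(1 - sin t) / s t \<le> tan (\<theta> t) / r"
        unfolding tan_cos[OF t, symmetric] using s_pos[of t] r by (simp add: field_simps)
      then show "1 / s t \<le> sin t / s t + tan (\<theta> t) / r"
        by (simp add: diff_divide_distrib)
    qed
    also have "\<dots> = ln (2 * (1 + r) / r') / r"
      unfolding ln_split add_divide_distrib ..
    also have "\<dots> \<le> ln (4 / r') / r"
      using r r' by (intro divide_right_mono ln_mono) (auto simp: divide_right_mono)
    finally show ?thesis .
  qed
  show "elliptic_K r \<ge> ln (2 * (1 + r) / r') - pi / 2 * r'"
  proof -
    note ln_split
    also have "ln ((1 + r) / r') \<le> ln ((1 + r) / r') / r"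
    proof -
      have "ln ((1 + r) / r') \<ge> 0" using r r' by (intro ln_ge_zero) simp
      then have "ln ((1 + r) / r') * r \<le> ln ((1 + r) / r') * 1"
        using r by (intro mult_left_mono) auto
      then show ?thesis using r by (simp add: field_simps)
    qed
    also have "ln ((1 + r) / r') / r + ln 2 - pi / 2 * r' \<le> elliptic_K r"
    proof (rule has_integral_le[OF has_integral_diff[OF has_integral_add[OF sin_part tan_part]] K])
      show "((\<lambda>t. r') has_integral pi / 2 * r') {0..pi / 2}"
        using has_integral_const_real[of r' 0 "pi / 2"] by simp
      fix t assume t: "t \<in> {0..pi / 2}"
      have cos_t: "cos t \<ge> 0" using t by (intro cos_ge_zero) auto
      have "(s t)\<^sup>2 \<le> (cos t + r')\<^sup>2"
      proof -
        have "(r * cos t)\<^sup>2 \<le> (1 * cos t)\<^sup>2"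
          using r cos_t by (intro power_mono mult_right_mono) auto
        moreover have "0 \<le> cos t * r'" using cos_t r' by simp
        ultimately show ?thesis by (simp add: s_cos power2_sum)
      qed
      then have "s t \<le> cos t + r'"
        by (rule power2_le_imp_le) (use cos_t r' in simp)
      then have "tan (\<theta> t) * s t \<le> tan (\<theta> t) * (cos t + r')"
        using tan_nonneg[OF t] by (rule mult_left_mono)
      also have "\<dots> = 1 - sin t + tan (\<theta> t) * r'"
        using tan_cos[OF t] by (simp add: distrib_left)
      also have "\<dots> \<le> 1 - sin t + s t * r'"
      proof -
        have "cos t \<le> s t"
        proof (rule power2_le_imp_le)
          have "r\<^sup>2 * (sin t)\<^sup>2 \<le> 1 * (sin t)\<^sup>2" using r2 by (intro mult_right_mono) auto
          then show "(cos t)\<^sup>2 \<le> (s t)\<^sup>2" by (simp add: s_sq cos_squared_eq)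
        qed (use s_pos[of t] in simp)
        with tan_le[OF t] have "tan (\<theta> t) \<le> s t" by simp
        with r' show ?thesis by (intro add_left_mono mult_right_mono) auto
      qed
      finally have "tan (\<theta> t) \<le> (1 - sin t + s t * r') / s t"
        using s_pos[of t] by (simp add: pos_le_divide_eq)
      also have "\<dots> = 1 / s t - sin t / s t + r'"
        using s_pos[of t] by (simp add: add_divide_distrib diff_divide_distrib)
      finally show "sin t / s t + tan (\<theta> t) - r' \<le> 1 / s t"
        by simp
    qed
    finally show ?thesis by simp
  qed
qed

lemma powser_le_sum_coeffs:
  fixes f :: "nat \<Rightarrow> real"
  assumes "\<And>n. f n \<ge> 0" "f sums S" "0 \<le> x" "x \<le> 1"
  shows "summable (\<lambda>n. f n * x ^ n)" "(\<Sum>n. f n * x ^ n) \<le> S"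
proof -
  have le: "f n * x ^ n \<le> f n" for n
    using assms by (intro mult_left_le power_le_one) auto
  show summ: "summable (\<lambda>n. f n * x ^ n)"
    by (rule summable_comparison_test'[OF sums_summable[OF assms(2)]])
       (use assms(1,3) le in auto)
  show "(\<Sum>n. f n * x ^ n) \<le> S"
    by (rule sums_le[OF le summable_sums[OF summ] assms(2)])
qed

text \<open>
  Abel's limit theorem is elementary for nonnegative coefficients: the series is at most \<open>S\<close> on
  \<open>{0<..<1}\<close> and at least each of its partial sums, which are continuous.
\<close>
lemma abel_limit_nonneg:
  fixes f :: "nat \<Rightarrow> real"
  assumes nonneg: "\<And>n. f n \<ge> 0" and sums: "f sums S"
  shows "((\<lambda>x. \<Sum>n. f n * x ^ n) \<longlongrightarrow> S) (at_left 1)"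
proof (rule order_tendstoI)
  have near: "\<forall>\<^sub>F x in at_left 1. x \<in> {0<..<1::real}"
    by (rule eventually_at_left_real) simp
  {
    fix y :: real assume "y < S"
    then have "\<forall>\<^sub>F N in sequentially. y < (\<Sum>i<N. f i)"
      using sums by (auto simp: sums_def intro: order_tendstoD)
    then obtain N where N: "y < (\<Sum>i<N. f i)"
      by (auto simp: eventually_sequentially)
    have "((\<lambda>x. \<Sum>i<N. f i * x ^ i) \<longlongrightarrow> (\<Sum>i<N. f i * 1 ^ i)) (at_left 1)"
      by (intro tendsto_intros)
    with N have "\<forall>\<^sub>F x in at_left 1. y < (\<Sum>i<N. f i * x ^ i)"
      by (auto intro: order_tendstoD)
    with near show "\<forall>\<^sub>F x in at_left 1. y < (\<Sum>n. f n * x ^ n)"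
    proof eventually_elim
      case (elim x)
      have "(\<Sum>i<N. f i * x ^ i) \<le> (\<Sum>n. f n * x ^ n)"
        using elim nonneg powser_le_sum_coeffs(1)[OF assms, of x] by (intro sum_le_suminf) auto
      with elim show ?case by simp
    qed
  next
    fix y :: real assume "S < y"
    from near show "\<forall>\<^sub>F x in at_left 1. (\<Sum>n. f n * x ^ n) < y"
    proof eventually_elim
      case (elim x)
      with powser_le_sum_coeffs(2)[OF assms, of x] \<open>S < y\<close> show ?case by simp
    qed
  }
qed

text \<open>
  The sum telescopes to Wallis's product.
\<close>
lemma wallis_step_sums_1: "wallis_step sums 1"
proof -
  have "(\<Sum>i<n. wallis_step i) = wallis_ratio n" for n
    by (induction n) (auto simp: wallis_ratio_Suc_diff[symmetric])
  then show ?thesis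
    using wallis_ratio_tendsto_1 by (simp add: sums_def)
qed

lemma abs_wallis_step_le_1: "\<bar>wallis_step n\<bar> \<le> 1"
  using sum_le_suminf[of wallis_step "{n}"] wallis_step_sums_1 wallis_step_nonneg by
      (auto simp: sums_iff)

text \<open>
  Equal to \<open>2 (1 - x) K'(x)\<close>, see \<open>K_series_deriv_step_series\<close>.
\<close>
definition step_series :: "real \<Rightarrow> real" where
  "step_series x = (\<Sum>n. wallis_step n * x ^ n)"

lemma step_series_sums:
  assumes "\<bar>x\<bar> < 1"
  shows "(\<lambda>n. wallis_step n * x ^ n) sums step_series x"
  unfolding step_series_def using assms abs_wallis_step_le_1
  by (intro summable_sums summable_bounded_powser[where B = 1])

lemma step_series_eq:
  assumes "\<bar>x\<bar> < 1"
  shows "step_series x = (1 - x) * (\<Sum>n. wallis_ratio (Suc n) * x ^ n)"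
proof -
  have S: "(\<lambda>n. wallis_ratio (Suc n) * x ^ n) sums (\<Sum>n. wallis_ratio (Suc n) * x ^ n)"
    using assms abs_wallis_ratio_le_1
    by (intro summable_sums summable_bounded_powser[where B = 1]) auto
  then have "(\<lambda>n. wallis_ratio (Suc n) * x ^ Suc n) sums (x * (\<Sum>n. wallis_ratio (Suc n) * x ^ n))"
    using sums_mult[OF S, of x] by (simp add: mult_ac)
  then have "(\<lambda>n. wallis_ratio n * x ^ n) sums (x * (\<Sum>n. wallis_ratio (Suc n) * x ^ n))"
    using sums_Suc_iff[of "\<lambda>n. wallis_ratio n * x ^ n"] by simp
  from sums_diff[OF S this] have "(\<lambda>n. wallis_step n * x ^ n)
      sums ((1 - x) * (\<Sum>n. wallis_ratio (Suc n) * x ^ n))"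
    by (simp add: wallis_ratio_Suc_diff[symmetric] algebra_simps)
  then show ?thesis
    by (simp add: step_series_def sums_iff)
qed

lemma K_series_deriv_step_series:
  assumes "\<bar>x\<bar> < 1"
  shows "(K_series has_real_derivative step_series x / (2 * (1 - x))) (at x)"
proof -
  have "(\<Sum>n. wallis_ratio (Suc n) * x ^ n) = step_series x / (1 - x)"
    using assms by (auto simp: step_series_eq)
  with K_series_deriv[OF assms] show ?thesis
    by (simp only: divide_divide_eq_left mult.commute)
qed

lemma step_series_nonneg: "0 \<le> x \<Longrightarrow> x < 1 \<Longrightarrow> step_series x \<ge> 0"
  using step_series_sums[of x] unfolding step_series_def
  by (intro suminf_nonneg) (auto simp: sums_iff wallis_step_nonneg)

lemma step_series_le_1: "0 \<le> x \<Longrightarrow> x < 1 \<Longrightarrow> step_series x \<le> 1"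
  unfolding step_series_def by (rule powser_le_sum_coeffs(2)[OF wallis_step_nonneg
      wallis_step_sums_1]) auto

lemma step_series_tendsto_1: "(step_series \<longlongrightarrow> 1) (at_left 1)"
  unfolding step_series_def[abs_def]
  by (rule abel_limit_nonneg[OF wallis_step_nonneg wallis_step_sums_1])

text \<open>
  The derivative is \<open>(step_series x - 1) / (2 (1 - x))\<close>, and \<open>step_series\<close> stays below its limit \<open>1\<close>.
\<close>
lemma K_series_plus_ln_antimono:
  assumes "0 \<le> x" "x \<le> y" "y < 1"
  shows "K_series y + ln (1 - y) / 2 \<le> K_series x + ln (1 - x) / 2"
proof (rule DERIV_nonpos_imp_nonincreasing[OF assms(2)])
  fix z assume z: "x \<le> z" "z \<le> y"
  have "((\<lambda>x. K_series x + ln (1 - x) / 2)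
      has_real_derivative (step_series z - 1) / (2 * (1 - z))) (at z)"
    by (rule derivative_eq_intros K_series_deriv_step_series refl | use assms z in force)+
       (use assms z in \<open>simp add: divide_simps\<close>, simp add: algebra_simps)
  moreover have "(step_series z - 1) / (2 * (1 - z)) \<le> 0"
    using step_series_le_1[of z] assms z by (intro divide_nonpos_pos) auto
  ultimately show "\<exists>d. ((\<lambda>x. K_series x + ln (1 - x) / 2) has_real_derivative d) (at z) \<and> d \<le> 0"
    by blast
qed

text \<open>
  By monotonicity it suffices to compare \<open>K_series + ln (1 - x) / 2\<close> with its limit at \<open>1\<close>, and the
  lower bound for the elliptic integral shows that this limit is at least \<open>ln 4\<close>. Applied
  at \<open>x\<close> itself, that bound would lose a multiple of \<open>sqrt (1 - x)\<close> in the exponent and thus only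
  bound the difference of the two sides from below by a negative constant.
\<close>
lemma exp_K_series_ge:
  assumes x: "0 \<le> x" "x < 1"
  shows "exp (K_series x) \<ge> 4 / sqrt (1 - x)"
proof -
  let ?b = "\<lambda>y. ln (2 * (1 + sqrt y) / sqrt (1 - y)) - pi / 2 * sqrt (1 - y) + ln (1 - y) / 2"
  have "(?b \<longlongrightarrow> ln 4) (at_left 1)"
    by real_asymp
  moreover have "\<forall>\<^sub>F y in at_left 1. ?b y \<le> K_series x + ln (1 - x) / 2"
  proof -
    have "\<forall>\<^sub>F y in at_left 1. y \<in> {x<..<1}"
      using x by (intro eventually_at_left_real)
    then show ?thesis
    proof eventually_elim
      case (elim y)
      then have "K_series y \<ge> ln (2 * (1 + sqrt y) / sqrt (1 - y)) - pi / 2 * sqrt (1 - y)"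
        using elliptic_K_bounds(2)[of "sqrt y"] elliptic_K_eq_K_series[of y] x by simp
      with K_series_plus_ln_antimono[of x y] elim x show ?case by simp
    qed
  qed
  ultimately have "ln 4 \<le> K_series x + ln (1 - x) / 2"
    by (intro tendsto_upperbound) auto
  then have "exp (ln 4 - ln (1 - x) / 2) \<le> exp (K_series x)"
    by simp
  also have "exp (ln 4 - ln (1 - x) / 2) = 4 / sqrt (1 - x)"
    using x by (simp add: exp_diff flip: ln_sqrt)
  finally show ?thesis .
qed

lemma G4_eq_K_series: "0 \<le> x \<Longrightarrow> x < 1 \<Longrightarrow> G4 x = exp (K_series x) - 4 / sqrt (1 - x)"
  by (simp add: G4_def elliptic_K_eq_K_series)

text \<open>
  With \<open>r = sqrt x\<close> the upper bound for the elliptic integral exceeds \<open>ln (4 / r')\<close> only by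
  \<open>(1 / r - 1) * ln (4 / r')\<close>, which is \<open>o(r')\<close>.
\<close>
lemma G4_tendsto_0: "(G4 \<longlongrightarrow> 0) (at_left 1)"
proof (rule tendsto_sandwich)
  let ?U = "\<lambda>x::real. exp (ln (4 / sqrt (1 - x)) / sqrt x) - 4 / sqrt (1 - x)"
  have near: "\<forall>\<^sub>F x in at_left 1. x \<in> {0<..<1::real}"
    by (rule eventually_at_left_real) simp
  from near show "\<forall>\<^sub>F x in at_left 1. 0 \<le> G4 x"
    by eventually_elim (use exp_K_series_ge in \<open>auto simp: G4_eq_K_series\<close>)
  from near show "\<forall>\<^sub>F x in at_left 1. G4 x \<le> ?U x"
  proof eventually_elim
    case (elim x)
    then show ?case
      using elliptic_K_bounds(1)[of "sqrt x"] by (simp add: G4_def)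
  qed
  show "(?U \<longlongrightarrow> 0) (at_left 1)"
    by real_asymp
qed simp

section \<open>The sign pattern of G4\<close>

lemma expK_wallis_quotient_less: "n > 0 \<Longrightarrow> expK_coeff n / wallis_coeff n
    < expK_coeff (Suc n) / wallis_coeff (Suc n)"
proof -
  assume n: "n > 0"
  have "expK_coeff (Suc n) / wallis_coeff (Suc n)
      = 2 * (real n + 1) * expK_coeff (Suc n) / ((2 * real n + 1) * wallis_coeff n)"
    using wallis_coeff_pos[of n] by (simp add: wallis_coeff_Suc divide_simps)
  also have "\<dots> = expK_coeff n / wallis_coeff n + ratio_gap n / ((2 * real n + 1) * wallis_coeff n)"
    unfolding expK_coeff_Suc_eq using wallis_coeff_pos[of n] by (simp add: add_divide_distrib)
  finally show ?thesis
    using ratio_gap_pos[OF n] wallis_coeff_pos[of n] by simp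
qed

text \<open>
  If the inequality failed at \<open>n\<close>, monotonicity of the quotient would give
  \<open>exp (pi / 2) * expK_coeff k \<ge> (4 + \<delta>) * wallis_coeff k\<close> for some \<open>\<delta> > 0\<close> and all \<open>k > n\<close>, and so
  \<open>G4 x \<ge> \<delta> / sqrt (1 - x) - D\<close>, in contradiction to \<open>G4_tendsto_0\<close>.
\<close>
lemma expK_coeff_less:
  assumes "n > 0"
  shows "exp (pi / 2) * expK_coeff n < 4 * wallis_coeff n"
proof (rule ccontr)
  assume "\<not> exp (pi / 2) * expK_coeff n < 4 * wallis_coeff n"
  then have ge: "4 \<le> exp (pi / 2) * (expK_coeff n / wallis_coeff n)"
    using wallis_coeff_pos[of n] by (simp add: field_simps)
  define \<delta> where "\<delta> = exp (pi / 2) * (expK_coeff (Suc n) / wallis_coeff (Suc n)) - 4"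
  have \<delta>: "\<delta> > 0"
    unfolding \<delta>_def using ge expK_wallis_quotient_less[OF assms]
    by (smt (verit) exp_gt_zero mult_less_cancel_left_pos)
  define e where "e k = exp (pi / 2) * expK_coeff k - (4 + \<delta>) * wallis_coeff k" for k
  have excess_nonneg: "e k \<ge> 0" if "k > n" for k
  proof -
    have "Suc n \<le> k" using that by simp
    then have "expK_coeff (Suc n) / wallis_coeff (Suc n) \<le> expK_coeff k / wallis_coeff k"
    proof (induction k rule: dec_induct)
      case (step k)
      with expK_wallis_quotient_less[of k] show ?case by simp
    qed simp
    then have "exp (pi / 2) * (expK_coeff (Suc n) / wallis_coeff (Suc n))
        \<le> exp (pi / 2) * (expK_coeff k / wallis_coeff k)"
      by (rule mult_left_mono) simp
    then have "4 + \<delta> \<le> exp (pi / 2) * (expK_coeff k / wallis_coeff k)"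
      unfolding \<delta>_def by linarith
    then show ?thesis
      using wallis_coeff_pos[of k] by (simp add: e_def field_simps)
  qed
  define D where "D = (\<Sum>k\<le>n. \<bar>e k\<bar>)"
  have lower: "\<delta> / sqrt (1 - x) - D \<le> G4 x" if x: "0 < x" "x < 1" for x
  proof -
    have "(\<lambda>k. exp (pi / 2) * expK_coeff k * x ^ k - (4 + \<delta>) * (wallis_coeff k * x ^ k))
        sums (exp (K_series x) - (4 + \<delta>) * (1 / sqrt (1 - x)))"
      using x by (intro sums_diff exp_K_series_sums sums_mult wallis_coeff_sums) auto
    then have e: "(\<lambda>k. e k * x ^ k) sums (exp (K_series x) - (4 + \<delta>) * (1 / sqrt (1 - x)))"
      by (simp add: e_def algebra_simps)
    have "- D = (\<Sum>k\<le>n. - \<bar>e k\<bar>)"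
      by (simp add: D_def sum_negf)
    also have "\<dots> \<le> (\<Sum>k\<le>n. e k * x ^ k)"
    proof (rule sum_mono)
      fix k
      have "\<bar>e k * x ^ k\<bar> \<le> \<bar>e k\<bar> * 1"
        unfolding abs_mult using x by (intro mult_left_mono) (auto simp: power_le_one)
      then show "- \<bar>e k\<bar> \<le> e k * x ^ k" by linarith
    qed
    also have "\<dots> \<le> (\<Sum>k. e k * x ^ k)"
      using x e excess_nonneg by (intro sum_le_suminf) (auto simp: sums_iff)
    also have "\<dots> = G4 x - \<delta> / sqrt (1 - x)"
      using e x by (simp add: sums_iff G4_eq_K_series algebra_simps add_divide_distrib)
    finally show ?thesis by simp
  qed
  have "filterlim (\<lambda>x::real. 1 / sqrt (1 - x)) at_top (at_left 1)"
    by real_asymp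
  then have "\<forall>\<^sub>F x in at_left 1. (D + 1) / \<delta> < 1 / sqrt (1 - x)"
    by (auto simp: filterlim_at_top_dense)
  moreover have "\<forall>\<^sub>F x in at_left 1. G4 x < 1"
    using G4_tendsto_0 by (rule order_tendstoD) simp
  moreover have "\<forall>\<^sub>F x in at_left 1. x \<in> {0<..<1::real}"
    by (rule eventually_at_left_real) simp
  ultimately have "\<forall>\<^sub>F x in at_left (1::real). False"
  proof eventually_elim
    case (elim x)
    then have "D + 1 < \<delta> / sqrt (1 - x)"
      using \<delta> by (simp add: field_simps)
    with lower[of x] elim show ?case by simp
  qed
  then show False by simp
qed

text \<open>
  The coefficients of \<open>G4 0 - G4 x\<close>.
\<close>
definition G4_drop :: "nat \<Rightarrow> real" where
  "G4_drop n = (if n = 0 then 0 else 4 * wallis_coeff n - exp (pi / 2) * expK_coeff n)"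

lemma G4_drop_0: "G4_drop 0 = 0"
  by (simp add: G4_drop_def)

lemma G4_drop_pos: "n > 0 \<Longrightarrow> G4_drop n > 0"
  using expK_coeff_less by (simp add: G4_drop_def)

lemma G4_drop_nonneg: "G4_drop n \<ge> 0"
  using G4_drop_pos[of n] by (cases "n = 0") (auto simp: G4_drop_0)

lemma G4_drop_sums:
  assumes "0 \<le> x" "x < 1"
  shows "(\<lambda>n. G4_drop n * x ^ n) sums (exp (pi / 2) - 4 - G4 x)"
proof -
  have "(\<lambda>n. 4 * (wallis_coeff n * x ^ n) - exp (pi / 2) * expK_coeff n * x ^ n)
      sums (4 * (1 / sqrt (1 - x)) - exp (K_series x))"
    using assms by (intro sums_diff exp_K_series_sums sums_mult wallis_coeff_sums) auto
  moreover have "(\<lambda>n. if n = 0 then exp (pi / 2) - 4 else 0) sums (exp (pi / 2) - 4)"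
    by (rule sums_single)
  ultimately have "(\<lambda>n. 4 * (wallis_coeff n * x ^ n) - exp (pi / 2) * expK_coeff n * x ^ n
      + (if n = 0 then exp (pi / 2) - 4 else 0))
      sums (4 * (1 / sqrt (1 - x)) - exp (K_series x) + (exp (pi / 2) - 4))"
    by (rule sums_add)
  also have "(\<lambda>n. 4 * (wallis_coeff n * x ^ n) - exp (pi / 2) * expK_coeff n * x ^ n + (if n
      = 0 then exp (pi / 2) - 4 else 0)) = (\<lambda>n. G4_drop n * x ^ n)"
    by (auto simp: G4_drop_def algebra_simps)
  also have "4 * (1 / sqrt (1 - x)) - exp (K_series x) + (exp (pi / 2) - 4)
      = exp (pi / 2) - 4 - G4 x"
    using assms by (simp add: G4_eq_K_series)
  finally show ?thesis .
qed

section \<open>Legendre's relation and the lemniscatic value\<close>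

text \<open>
  Equal to \<open>x (1 - x) K'(x)\<close>, so that the hypergeometric differential equation of \<open>K\<close> reads
  \<open>4 K_flux' = K\<close>.
\<close>
definition K_flux :: "real \<Rightarrow> real" where
  "K_flux x = x * step_series x / 2"

lemma K_flux_deriv:
  assumes x: "\<bar>x\<bar> < 1"
  shows "(K_flux has_real_derivative K_series x / 4) (at x)"
proof -
  define e where "e n = (case n of 0 \<Rightarrow> 0 | Suc k \<Rightarrow> wallis_step k / 2)" for n
  have e_bound: "\<bar>e n\<bar> \<le> 1" for n
    using abs_wallis_step_le_1[of "n - 1"] by (auto simp: e_def split: nat.splits)
  have "((\<lambda>x. \<Sum>n. e n * x ^ n) has_real_derivative (\<Sum>n. diffs e n * x ^ n)) (at x)"
    using x e_bound by (intro termdiffs_strong'[of 1] summable_bounded_powser[where B = 1]) auto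
  moreover have "(\<Sum>n. diffs e n * x ^ n) = K_series x / 4"
  proof -
    have "(\<lambda>n. diffs e n * x ^ n) = (\<lambda>n. pi / 2 * (wallis_coeff n)\<^sup>2 * x ^ n / 4)"
      by (rule ext) (simp add: diffs_def e_def wallis_step_def divide_simps)
    moreover have "summable (\<lambda>n. pi / 2 * (wallis_coeff n)\<^sup>2 * x ^ n)"
      using x by (intro summable_bounded_powser[OF K_series_coeff_bound])
    ultimately show ?thesis
      unfolding K_series_def by (simp only: suminf_divide)
  qed
  moreover have "(\<Sum>n. e n * y ^ n) = K_flux y" if y: "\<bar>y\<bar> < 1" for y
  proof -
    have "(\<lambda>n. y / 2 * (wallis_step n * y ^ n)) sums (y / 2 * step_series y)"
      using y by (intro sums_mult step_series_sums)
    then have "(\<lambda>n. e (Suc n) * y ^ Suc n) sums (K_flux y)"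
      by (simp add: e_def K_flux_def mult_ac)
    then have "(\<lambda>n. e n * y ^ n) sums (K_flux y)"
      using sums_Suc_iff[of "\<lambda>n. e n * y ^ n"] by (simp add: e_def)
    then show ?thesis by (simp add: sums_iff)
  qed
  moreover have "\<forall>\<^sub>F y in nhds x. \<bar>y\<bar> < 1"
  proof -
    have "open {-1<..<1::real}" "x \<in> {-1<..<1}" using x by auto
    then have "\<forall>\<^sub>F y in nhds x. y \<in> {-1<..<1}" by (rule eventually_nhds_in_open)
    then show ?thesis by eventually_elim auto
  qed
  ultimately show ?thesis
    by (subst DERIV_cong_ev[OF refl _ refl, of _ "\<lambda>x. \<Sum>n. e n * x ^ n"])
       (auto elim!: eventually_mono)
qed

text \<open>
  The left-hand side is a Wronskian of the two solutions \<open>K(x)\<close> and \<open>K(1 - x)\<close> of the self-adjoint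
  equation \<open>4 (x (1 - x) K')' = K\<close>, hence constant. Its value is read off at \<open>x = 0\<close>, where the second
  product vanishes because \<open>K(1 - x)\<close> has only a logarithmic singularity.
\<close>
lemma legendre_relation:
  assumes x: "0 < x" "x < 1"
  shows "K_series x * K_flux (1 - x) + K_series (1 - x) * K_flux x = pi / 4"
proof -
  define L where "L = (\<lambda>x. K_series x * K_flux (1 - x) + K_series (1 - x) * K_flux x)"
  have const: "L z = L x" if z: "0 < z" "z < 1" for z
  proof (rule DERIV_isconst3[where f = L and a = 0 and b = 1])
    fix t :: real assume "t \<in> {0<..<1}"
    then have t: "0 < t" "t < 1" "\<bar>t\<bar> < 1" "\<bar>1 - t\<bar> < 1" by auto
    have reflect: "((\<lambda>x. 1 - x) has_real_derivative - 1) (at t)"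
      by (auto intro!: derivative_eq_intros)
    have k': "((\<lambda>x. K_series (1 - x))
        has_real_derivative step_series (1 - t) / (2 * t) * (- 1)) (at t)"
      using t DERIV_chain2[OF _ reflect, of K_series "step_series (1 - t) / (2
          * t)"] K_series_deriv_step_series[OF t(4)] by simp
    have y': "((\<lambda>x. K_flux (1 - x)) has_real_derivative K_series (1 - t) / 4 * (- 1)) (at t)"
      using t DERIV_chain2[OF _ reflect, of K_flux "K_series (1
          - t) / 4"] K_flux_deriv[OF t(4)] by simp
    have "(L has_real_derivative
       (K_series t * (K_series (1 - t) / 4 * (- 1)) + step_series t / (2 * (1 - t)) * K_flux (1 -
         t)) +
       (K_series (1 - t) * (K_series t / 4) + step_series (1 - t) / (2 * t) * (- 1) * K_flux t))
         (at t)"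
      unfolding L_def by (intro DERIV_add DERIV_mult' K_series_deriv_step_series K_flux_deriv k'
          y' t)
    also have "(K_series t * (K_series (1 - t) / 4 * (- 1)) + step_series t / (2 * (1 - t))
        * K_flux (1 - t)) +
       (K_series (1 - t) * (K_series t / 4) + step_series (1 - t) / (2 * t) * (- 1) * K_flux t) = 0"
      using t by (simp add: K_flux_def divide_simps) (simp add: algebra_simps)
    finally show "(L has_real_derivative 0) (at t)" .
  qed (use x z in auto)
  have at0: "\<forall>\<^sub>F z in at_right 0. z \<in> {0<..<1::real}"
    by (rule eventually_at_right_real) simp
  \<comment> \<open>\<open>K(0) = pi / 2\<close> and \<open>step_series\<close> tends to \<open>1\<close> at \<open>1\<close>\<close>
  have "(L \<longlongrightarrow> pi / 2 * ((1 - 0) * 1 / 2) + 0) (at_right 0)"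
    unfolding L_def
  proof (rule tendsto_add)
    have "isCont K_series 0"
      using K_series_deriv[of 0] by (intro DERIV_isCont) auto
    then have "(K_series \<longlongrightarrow> pi / 2) (at_right 0)"
      by (auto simp: isCont_def K_series_0 intro: filterlim_at_split[THEN iffD1, THEN conjunct2])
    moreover have "((\<lambda>z. K_flux (1 - z)) \<longlongrightarrow> (1 - 0) * 1 / 2) (at_right 0)"
    proof -
      have "((\<lambda>z. step_series (1 - z)) \<longlongrightarrow> 1) (at_right 0)"
      proof (rule filterlim_compose[OF step_series_tendsto_1])
        show "filterlim (\<lambda>z::real. 1 - z) (at_left 1) (at_right 0)"
          by real_asymp
      qed
      then show ?thesis
        unfolding K_flux_def by (intro tendsto_intros) auto
    qed
    ultimately show "((\<lambda>z. K_series z * K_flux (1 - z)) \<longlongrightarrow> pi / 2 * ((1 - 0) * 1 / 2)) (at_right 0)"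
      by (rule tendsto_mult)
    show "((\<lambda>z. K_series (1 - z) * K_flux z) \<longlongrightarrow> 0) (at_right 0)"
    proof (rule tendsto_sandwich)
      let ?U = "\<lambda>z::real. ln (4 / sqrt z) / sqrt (1 - z) * (z / 2)"
      from at0 show "\<forall>\<^sub>F z in at_right 0. 0 \<le> K_series (1 - z) * K_flux z"
      proof eventually_elim
        case (elim z)
        then have z: "0 < z" "z < 1" by auto
        have "K_series (1 - z) \<ge> 0"
          unfolding K_series_def using z
          by (intro suminf_nonneg summable_bounded_powser[OF K_series_coeff_bound]) auto
        with z step_series_nonneg[of z] show ?case by (simp add: K_flux_def)
      qed
      from at0 show "\<forall>\<^sub>F z in at_right 0. K_series (1 - z) * K_flux z \<le> ?U z"
      proof eventually_elim
        case (elim z)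
        then have z: "0 < z" "z < 1" by auto
        have "K_series (1 - z) \<le> ln (4 / sqrt z) / sqrt (1 - z)"
          using z elliptic_K_bounds(1)[of "sqrt (1 - z)"] elliptic_K_eq_K_series[of "1 - z"] by simp
        moreover have "K_flux z \<le> z / 2"
          using z step_series_le_1[of z] by (simp add: K_flux_def mult_left_le)
        moreover have "K_flux z \<ge> 0"
          using z step_series_nonneg[of z] by (simp add: K_flux_def)
        moreover have "ln (4 / sqrt z) / sqrt (1 - z) \<ge> 0"
          using z by (intro divide_nonneg_nonneg ln_ge_zero)
              (auto simp: field_simps intro: order_trans[of _ 1])
        ultimately show ?case by (intro mult_mono)
      qed
      show "(?U \<longlongrightarrow> 0) (at_right 0)"
        by real_asymp
    qed simp
  qed
  then have "(L \<longlongrightarrow> pi / 4) (at_right 0)" by simp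
  moreover have "\<forall>\<^sub>F z in at_right 0. L z = L x"
    using at0 by eventually_elim (use const in auto)
  then have "(L \<longlongrightarrow> L x) (at_right 0)"
    by (rule tendsto_eventually)
  ultimately have "L x = pi / 4"
    by (intro tendsto_unique[of "at_right 0" L]) auto
  then show ?thesis by (simp add: L_def)
qed

text \<open>
  Legendre's relation at its fixed point \<open>x = 1/2\<close>; there \<open>step_series\<close> coincides with \<open>K'\<close>.
\<close>
lemma step_series_half: "step_series (1 / 2) * K_series (1 / 2) = pi / 2"
  using legendre_relation[of "1/2"] by (simp add: K_flux_def mult_ac)

lemma Gamma_quarter_mult: "Gamma (1 / 4) * Gamma (3 / 4) = pi * sqrt (2 :: real)"
proof -
  have "Gamma (complex_of_real (1 / 4)) * Gamma (1 - complex_of_real (1 / 4)) =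
      of_real pi / sin (of_real pi * complex_of_real (1 / 4))"
    by (rule Gamma_reflection_complex)
  also have "1 - complex_of_real (1 / 4) = complex_of_real (3 / 4)"
    by simp
  also have "of_real pi / sin (of_real pi * complex_of_real (1 / 4))
      = complex_of_real (pi / sin (pi / 4))"
    by (simp flip: sin_of_real)
  finally have "complex_of_real (Gamma (1 / 4) * Gamma (3 / 4))
      = complex_of_real (pi / sin (pi / 4))"
    by (simp only: Gamma_complex_of_real of_real_mult)
  then have "Gamma (1 / 4) * Gamma (3 / 4) = pi / sin (pi / 4)"
    by (simp only: of_real_eq_iff)
  also have "\<dots> = pi * (2 / sqrt 2)"
    by (simp add: sin_45)
  also have "2 / sqrt 2 = sqrt (2 :: real)"
    by (rule real_div_sqrt) simp
  finally show ?thesis .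
qed

text \<open>
  The substitution \<open>y = cos t ^ 4\<close> turns the Beta integral with parameters \<open>1/4\<close> and \<open>1/2\<close> into a
  multiple of the elliptic integral with \<open>r\<^sup>2 = 1/2\<close>.
\<close>
lemma K_series_half: "K_series (1 / 2) = (Gamma (1 / 4))\<^sup>2 / (4 * sqrt pi)"
proof -
  define g where "g t = cos t ^ 4" for t :: real
  define f where "f y = y powr (1 / 4 - 1) * (1 - y) powr (1 / 2 - 1)" for y :: real
  have "(f has_integral Beta (1 / 4) (1 / 2)) {0..1}"
    unfolding f_def by (intro has_integral_Beta_real) auto
  then have f: "(f has_integral Beta (1 / 4) (1 / 2)) {0<..<1}"
    by (simp add: has_integral_Icc_iff_Ioo)
  have abs: "f absolutely_integrable_on {0<..<1}"
    by (rule nonnegative_absolutely_integrable_1) (use f in \<open>auto simp: f_def has_integral_iff\<close>)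
  have deriv: "(g has_real_derivative - 4 * cos t ^ 3 * sin t) (at t within S)" for t S
    unfolding g_def by (auto intro!: derivative_eq_intros)
  have image: "g ` {0<..<pi / 2} = {0<..<1}"
  proof (intro equalityI subsetI)
    fix y assume "y \<in> g ` {0<..<pi / 2}"
    then obtain t where t: "0 < t" "t < pi / 2" "y = g t" by auto
    have "0 < cos t" using t by (intro cos_gt_zero) auto
    moreover have "cos t < 1"
      using t cos_monotone_0_pi[of 0 t] by simp
    ultimately show "y \<in> {0<..<1}"
      using t by (auto simp: g_def power_less_one_iff)
  next
    fix y :: real assume y: "y \<in> {0<..<1}"
    define z where "z = root 4 y"
    have z: "0 < z" "z < 1" "z ^ 4 = y"
      using y by (auto simp: z_def)
    have "arccos z > 0" "arccos z < pi / 2"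
      using z arccos_less_mono[of 1 z] arccos_less_mono[of z 0] by auto
    moreover have "g (arccos z) = y"
      using z by (simp add: g_def)
    ultimately show "y \<in> g ` {0<..<pi / 2}"
      by (intro image_eqI[of _ _ "arccos z"]) auto
  qed
  have inj: "inj_on g {0<..<pi / 2}"
  proof (rule inj_onI)
    fix s t assume st: "s \<in> {0<..<pi / 2}" "t \<in> {0<..<pi / 2}" "g s = g t"
    have "cos s > 0" "cos t > 0" using st by (auto intro: cos_gt_zero)
    with st have "cos s = cos t"
      using power_eq_imp_eq_base[of "cos s" 4 "cos t"] by (simp add: g_def)
    then show "s = t"
      using st by (auto dest: cos_inj_pi[rotated 4])
  qed
  have "(\<lambda>t. \<bar>- 4 * cos t ^ 3 * sin t\<bar> * f (g t)) absolutely_integrable_on {0<..<pi / 2} \<and>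
      integral {0<..<pi / 2} (\<lambda>t. \<bar>- 4 * cos t ^ 3 * sin t\<bar> * f (g t)) = Beta (1 / 4) (1 / 2)"
    by (subst has_absolute_integral_change_of_variables_1'[OF _ deriv inj])
       (use abs f in \<open>auto simp: image has_integral_iff\<close>)
  then have has_int: "((\<lambda>t. \<bar>- 4 * cos t ^ 3 * sin t\<bar> * f (g t))
      has_integral Beta (1 / 4) (1 / 2)) {0<..<pi / 2}"
    using set_lebesgue_integral_eq_integral(1) by (auto simp: has_integral_iff)
  have integrand: "\<bar>- 4 * cos t ^ 3 * sin t\<bar> * f (g t)
      = 2 * sqrt 2 * (1 / sqrt (1 - (sqrt (1 / 2))\<^sup>2 * (sin t)\<^sup>2))"
    if t: "t \<in> {0<..<pi / 2}" for t
  proof -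
    have pos: "cos t > 0" "sin t > 0"
      using t by (auto intro: cos_gt_zero sin_gt_zero2)
    have "g t powr (1 / 4 - 1) = cos t powr (- 3)"
    proof -
      have "g t = cos t powr 4" using pos by (simp add: g_def powr_numeral)
      then show ?thesis by (simp add: powr_powr)
    qed
    also have "\<dots> = 1 / cos t ^ 3"
      using pos by (simp add: powr_minus_divide powr_numeral)
    finally have 1: "g t powr (1 / 4 - 1) = 1 / cos t ^ 3" .
    have "1 - g t = (sin t)\<^sup>2 * (1 + (cos t)\<^sup>2)"
      unfolding g_def sin_squared_eq by algebra
    then have "(1 - g t) powr (1 / 2 - 1) = 1 / (sin t * sqrt (1 + (cos t)\<^sup>2))"
      using pos by (simp add: powr_minus_divide powr_half_sqrt real_sqrt_mult)
    with 1 have "\<bar>- 4 * cos t ^ 3 * sin t\<bar> * f (g t) = 4 / sqrt (1 + (cos t)\<^sup>2)"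
      using pos by (simp add: f_def abs_mult)
    also have "1 + (cos t)\<^sup>2 = 2 * (1 - (sqrt (1 / 2))\<^sup>2 * (sin t)\<^sup>2)"
      by (simp add: cos_squared_eq real_sqrt_pow2 algebra_simps)
    also have "4 / sqrt (2 * (1 - (sqrt (1 / 2))\<^sup>2 * (sin t)\<^sup>2)) =
        2 * sqrt 2 * (1 / sqrt (1 - (sqrt (1 / 2))\<^sup>2 * (sin t)\<^sup>2))"
      unfolding real_sqrt_mult by (simp add: divide_simps)
    finally show ?thesis .
  qed
  have "((\<lambda>t. 2 * sqrt 2 * (1 / sqrt (1 - (sqrt (1 / 2))\<^sup>2 * (sin t)\<^sup>2)))
      has_integral Beta (1 / 4) (1 / 2)) {0<..<pi / 2}"
    by (rule has_integral_eq[OF integrand has_int])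
  then have "((\<lambda>t. 2 * sqrt 2 * (1 / sqrt (1 - (sqrt (1 / 2))\<^sup>2 * (sin t)\<^sup>2)))
      has_integral Beta (1 / 4) (1 / 2)) {0..pi / 2}"
    by (simp add: has_integral_Icc_iff_Ioo)
  then have "Beta (1 / 4) (1 / 2) = 2 * sqrt 2 * elliptic_K (sqrt (1 / 2))"
    unfolding elliptic_K_def by (metis integral_mult_right integral_unique)
  also have "elliptic_K (sqrt (1 / 2)) = K_series (1 / 2)"
    by (rule elliptic_K_eq_K_series) auto
  finally have "K_series (1 / 2) = Beta (1 / 4) (1 / 2) / (2 * sqrt 2)"
    by simp
  also have "Beta (1 / 4) (1 / 2 :: real) = Gamma (1 / 4) * sqrt pi / Gamma (3 / 4)"
    by (simp add: Beta_def Gamma_one_half_real)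
  also have "Gamma (3 / 4 :: real) = pi * sqrt 2 / Gamma (1 / 4)"
  proof -
    have "Gamma (1 / 4 :: real) > 0" by (rule Gamma_real_pos) simp
    then have "Gamma (1 / 4 :: real) \<noteq> 0" by linarith
    from nonzero_mult_div_cancel_left[OF this, of "Gamma (3 / 4)"] show ?thesis
      unfolding Gamma_quarter_mult by (rule sym)
  qed
  also have "Gamma (1 / 4) * sqrt pi / (pi * sqrt 2 / Gamma (1 / 4)) / (2 * sqrt 2)
      = (Gamma (1 / 4))\<^sup>2 * (sqrt pi / (4 * pi))"
    by (simp add: power2_eq_square mult_ac)
  also have "sqrt pi / (4 * pi) = 1 / (4 * sqrt pi)"
    by (simp add: divide_simps flip: power2_eq_square)
  finally show ?thesis by simp
qed

section \<open>Recentring power series with nonnegative coefficients\<close>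

text \<open>
  The Taylor coefficients at \<open>z\<close> of the power series with coefficients \<open>f\<close>.
\<close>
definition recentred :: "(nat \<Rightarrow> real) \<Rightarrow> real \<Rightarrow> nat \<Rightarrow> real" where
  "recentred f z j = (\<Sum>\<^sub>\<infinity>n. f n * (n choose j) * z ^ (n - j))"

context
  fixes f :: "nat \<Rightarrow> real" and z s :: real
  assumes nonneg: "\<And>n. f n \<ge> 0" and z: "z \<ge> 0"
    and summable: "summable (\<lambda>n. f n * (z + \<bar>s\<bar>) ^ n)"
begin

private lemma binomial_row_has_sum:
  "((\<lambda>j. f n * (n choose j) * z ^ (n - j) * t ^ j) has_sum f n * (z + t) ^ n) (UNIV :: nat set)"
proof -
  have "f n * (z + t) ^ n = (\<Sum>j\<le>n. f n * (n choose j) * z ^ (n - j) * t ^ j)"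
    by (subst add.commute) (simp add: binomial_ring sum_distrib_left mult_ac)
  moreover have "((\<lambda>j. f n * (n choose j) * z ^ (n - j) * t ^ j) has_sum
      (\<Sum>j\<le>n. f n * (n choose j) * z ^ (n - j) * t ^ j)) UNIV"
    by (rule has_sum_finite_neutralI) (auto simp: not_le)
  ultimately show ?thesis by simp
qed

text \<open>
  Expanding every \<open>(z + s) ^ n\<close> gives a double series. It converges absolutely because replacing \<open>s\<close> by
  \<open>\<bar>s\<bar>\<close> makes all terms nonnegative and the rows sum to \<open>f n * (z + \<bar>s\<bar>) ^ n\<close>.
\<close>
private lemma double_series_has_sum:
  "((\<lambda>(j, n). f n * (n choose j) * z ^ (n - j) * s ^ j)
      has_sum (\<Sum>n. f n * (z + s) ^ n)) (UNIV \<times> UNIV)"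
proof -
  have "((\<lambda>(n, j). f n * (n choose j) * z ^ (n - j) * s ^ j)
      has_sum (\<Sum>n. f n * (z + s) ^ n)) (UNIV \<times> UNIV)"
  proof (rule has_sum_SigmaI)
    show "((\<lambda>j. case (n, j) of (n, j) \<Rightarrow> f n * (n choose j) * z ^ (n - j) * s ^ j)
        has_sum f n * (z + s) ^ n) UNIV" for n
      using binomial_row_has_sum by simp
    have abs: "summable (\<lambda>n. norm (f n * (z + s) ^ n))"
    proof (rule summable_comparison_test'[OF summable])
      fix n
      have "\<bar>z + s\<bar> \<le> z + \<bar>s\<bar>" using z by linarith
      then show "norm (norm (f n * (z + s) ^ n)) \<le> f n * (z + \<bar>s\<bar>) ^ n"
        using nonneg by (auto simp: abs_mult power_abs intro!: mult_left_mono power_mono)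
    qed
    show "((\<lambda>n. f n * (z + s) ^ n) has_sum (\<Sum>n. f n * (z + s) ^ n)) UNIV"
      by (rule norm_summable_imp_has_sum[OF abs summable_sums[OF summable_norm_cancel[OF abs]]])
    have "(\<lambda>(n, j). f n * (n choose j) * z ^ (n - j) * \<bar>s\<bar> ^ j) summable_on (UNIV \<times> UNIV)"
    proof (rule summable_on_SigmaI)
      show "((\<lambda>j. case (n, j) of (n, j) \<Rightarrow> f n * (n choose j) * z ^ (n - j) * \<bar>s\<bar> ^ j)
          has_sum f n * (z + \<bar>s\<bar>) ^ n) UNIV" for n
        using binomial_row_has_sum by simp
      show "(\<lambda>n. f n * (z + \<bar>s\<bar>) ^ n) summable_on UNIV"
        using nonneg z summable by (subst summable_on_UNIV_nonneg_real_iff) auto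
    qed (use z in \<open>auto intro!: mult_nonneg_nonneg nonneg\<close>)
    then have "(\<lambda>x. norm (case x of (n, j) \<Rightarrow> f n * (n choose j) * z ^ (n - j) * s ^ j))
        summable_on (UNIV \<times> UNIV)"
      using z by (simp add: case_prod_unfold abs_mult power_abs nonneg)
    then show "(\<lambda>(n, j). f n * (n choose j) * z ^ (n - j) * s ^ j) summable_on (UNIV \<times> UNIV)"
      by (rule abs_summable_summable)
  qed
  from has_sum_swap[THEN iffD1, OF this] show ?thesis by simp
qed

private lemma column_has_sum:
  "((\<lambda>n. f n * (n choose j) * z ^ (n - j) * s ^ j) has_sum recentred f z j * s ^ j) UNIV"
proof -
  have "(\<lambda>(j, n). f n * (n choose j) * z ^ (n - j) * s ^ j) summable_on (UNIV \<times> UNIV)"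
    using double_series_has_sum by (auto simp: summable_on_def)
  then have "(\<lambda>n. f n * (n choose j) * z ^ (n - j) * s ^ j) summable_on UNIV"
    by (rule summable_on_SigmaD1[where f = "\<lambda>j n. f n * (n choose j) * z ^ (n - j) * s ^ j"]) auto
  then show ?thesis
    unfolding recentred_def infsum_cmult_left'[symmetric] by (rule has_sum_infsum)
qed

lemma recentred_sums: "(\<lambda>j. recentred f z j * s ^ j) sums (\<Sum>n. f n * (z + s) ^ n)"
proof -
  have "((\<lambda>j. recentred f z j * s ^ j) has_sum (\<Sum>n. f n * (z + s) ^ n)) UNIV"
    using double_series_has_sum by (rule has_sum_SigmaD) (simp add: column_has_sum)
  then show ?thesis
    by (rule has_sum_imp_sums)
qed

text \<open>
  The coefficient with index \<open>j\<close> receives \<open>f j\<close> itself from the row \<open>n = j\<close>. The assumption on \<open>s\<close>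
  makes sure that the infinite sum defining it converges.
\<close>
lemma recentred_ge:
  assumes "s > 0"
  shows "f j \<le> recentred f z j"
proof -
  have "(\<Sum>n\<in>{j}. f n * (n choose j) * z ^ (n - j) * s ^ j) \<le> recentred f z j * s ^ j"
    using assms z by (intro finite_sum_le_has_sum[OF column_has_sum])
        (auto intro!: mult_nonneg_nonneg nonneg)
  with assms show ?thesis by simp
qed

end

definition G4_drop_half :: "nat \<Rightarrow> real" where
  "G4_drop_half = recentred G4_drop (1 / 2)"

lemma summable_G4_drop: "0 \<le> x \<Longrightarrow> x < 1 \<Longrightarrow> summable (\<lambda>n. G4_drop n * x ^ n)"
  using G4_drop_sums by (auto simp: sums_iff)

lemma G4_drop_half_sums:
  assumes s: "\<bar>s\<bar> < 1 / 2"
  shows "(\<lambda>j. G4_drop_half j * s ^ j) sums (exp (pi / 2) - 4 - G4 (1 / 2 + s))"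
proof -
  have "(\<lambda>j. G4_drop_half j * s ^ j) sums (\<Sum>n. G4_drop n * (1 / 2 + s) ^ n)"
    unfolding G4_drop_half_def using s
    by (intro recentred_sums G4_drop_nonneg summable_G4_drop) auto
  also have "(\<Sum>n. G4_drop n * (1 / 2 + s) ^ n) = exp (pi / 2) - 4 - G4 (1 / 2 + s)"
    using s G4_drop_sums[of "1 / 2 + s"] by (auto simp: sums_iff)
  finally show ?thesis .
qed

lemma G4_drop_le_half: "G4_drop j \<le> G4_drop_half j"
  unfolding G4_drop_half_def by (rule recentred_ge[where s = "1 / 4"])
      (auto intro!: G4_drop_nonneg summable_G4_drop)

lemma G4_drop_half_nonneg: "G4_drop_half j \<ge> 0"
  using G4_drop_le_half[of j] G4_drop_nonneg[of j] by linarith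

lemma G4_drop_half_pos: "j > 0 \<Longrightarrow> G4_drop_half j > 0"
  using G4_drop_le_half[of j] G4_drop_pos[of j] by linarith

section \<open>The symmetric difference quotient\<close>

text \<open>
  Taking the odd part in \<open>s\<close> and dividing by \<open>s\<close> keeps the coefficients with odd index and shifts
  them by one.
\<close>
definition H_coeff :: "nat \<Rightarrow> real" where
  "H_coeff j = (if even j then G4_drop_half (Suc j) else 0)"

definition H_series :: "real \<Rightarrow> real" where
  "H_series s = (\<Sum>j. H_coeff j * s ^ j)"

lemma H_coeff_nonneg: "H_coeff j \<ge> 0"
  by (simp add: H_coeff_def G4_drop_half_nonneg)

lemma H_coeff_sums:
  assumes s: "\<bar>s\<bar> < 1 / 2" "s \<noteq> 0"
  shows "(\<lambda>j. H_coeff j * s ^ j) sums H_fun (1 / 2 + s)"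
proof -
  have "(\<lambda>j. G4_drop_half j * s ^ j) sums (exp (pi / 2) - 4 - G4 (1 / 2 + s))"
    "(\<lambda>j. G4_drop_half j * (- s) ^ j) sums (exp (pi / 2) - 4 - G4 (1 / 2 + - s))"
    using s by (intro G4_drop_half_sums; simp)+
  from sums_divide[OF sums_diff[OF this], of "2 * s"]
  have "(\<lambda>j. (G4_drop_half j * s ^ j - G4_drop_half j * (- s) ^ j) / (2 * s))
      sums ((G4 (1 / 2 - s) - G4 (1 / 2 + s)) / (2 * s))"
    by simp
  also have "(G4 (1 / 2 - s) - G4 (1 / 2 + s)) / (2 * s) = H_fun (1 / 2 + s)"
    using s by (simp add: H_fun_def divide_simps)
  finally have "(\<lambda>j. (G4_drop_half (Suc j) * s ^ Suc j - G4_drop_half (Suc j)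
      * (- s) ^ Suc j) / (2 * s)) sums H_fun (1 / 2 + s)"
    by (subst sums_Suc_iff) simp
  also have "(\<lambda>j. (G4_drop_half (Suc j) * s ^ Suc j - G4_drop_half (Suc j) * (- s) ^ Suc j) / (2
      * s)) = (\<lambda>j. H_coeff j * s ^ j)"
    using s by (auto simp: H_coeff_def fun_eq_iff)
  finally show ?thesis .
qed

lemma H_series_eq_H_fun:
  assumes "\<bar>s\<bar> < 1 / 2" "s \<noteq> 0"
  shows "H_series s = H_fun (1 / 2 + s)"
  using H_coeff_sums[OF assms] by (simp add: H_series_def sums_iff)

lemma summable_H_coeff: "\<bar>s\<bar> < 1 / 2 \<Longrightarrow> summable (\<lambda>j. H_coeff j * s ^ j)"
  using H_coeff_sums[of s] by (cases "s = 0")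
      (auto simp: sums_iff powser_zero intro: summable_finite[of "{0}"])

lemma abs_minus_half_less: "x \<in> {0<..<1} \<Longrightarrow> \<bar>x - 1 / 2\<bar> < (1 / 2 :: real)"
  by (rule abs_less_iff[THEN iffD2]) auto

text \<open>
  Differentiation shifts the parity pattern of the coefficients by one. On the left of \<open>1/2\<close> this
  parity is what makes the signs of the derivatives alternate.
\<close>
lemma higher_diffs_H_coeff:
  fixes i :: nat
  shows "\<bar>s\<bar> < 1 / 2 \<Longrightarrow> summable (\<lambda>j. (diffs ^^ i) H_coeff j * s ^ j)"
    and "(diffs ^^ i) H_coeff j \<ge> 0"
    and "odd (i + j) \<Longrightarrow> (diffs ^^ i) H_coeff j = 0"
proof (induction i arbitrary: s j)
  case 0
  { case 1 then show ?case using summable_H_coeff by simp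
  next case 2 then show ?case using H_coeff_nonneg by simp
  next case 3 then show ?case by (simp add: H_coeff_def) }
next
  case (Suc i)
  { case 1
    then show ?case
      using Suc.IH(1) by (auto intro!: termdiff_converges[of s "1 / 2"])
  next
    case 2
    then show ?case using Suc.IH(2) by (simp add: diffs_def)
  next
    case 3
    then show ?case using Suc.IH(3)[of "Suc j"] by (simp add: diffs_def) }
qed

lemma higher_deriv_H_fun:
  assumes "x \<in> {0<..<1} - {1 / 2}"
  shows "(deriv ^^ i) H_fun x = (\<Sum>j. (diffs ^^ i) H_coeff j * (x - 1 / 2) ^ j)"
    and "(deriv ^^ i) H_fun differentiable (at x)"
proof -
  have eq_imp_deriv: "((deriv ^^ i) H_fun
      has_real_derivative (\<Sum>j. (diffs ^^ Suc i) H_coeff j * (x - 1 / 2) ^ j)) (at x)"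
    if x: "x \<in> {0<..<1} - {1 / 2}"
      and eq: "\<And>x. x \<in> {0<..<1} - {1 / 2} \<Longrightarrow> (deriv ^^ i) H_fun x
          = (\<Sum>j. (diffs ^^ i) H_coeff j * (x - 1 / 2) ^ j)"
    for x i
  proof -
    have "((\<lambda>s. \<Sum>j. (diffs ^^ i) H_coeff j * s ^ j)
        has_real_derivative (\<Sum>j. (diffs ^^ Suc i) H_coeff j * (x - 1 / 2) ^ j)) (at (x - 1 / 2))"
    proof -
      have "\<bar>x - 1 / 2\<bar> < 1 / 2" using x by (intro abs_minus_half_less) auto
      then show ?thesis
        using higher_diffs_H_coeff(1)[of _ i] by (simp, intro termdiffs_strong'[of "1 / 2"]) auto
    qed
    moreover have "((\<lambda>x. x - 1 / 2) has_real_derivative 1) (at x)"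
      by (auto intro!: derivative_eq_intros)
    ultimately have "((\<lambda>x. \<Sum>j. (diffs ^^ i) H_coeff j * (x - 1 / 2) ^ j)
        has_real_derivative (\<Sum>j. (diffs ^^ Suc i) H_coeff j * (x - 1 / 2) ^ j)) (at x)"
      using DERIV_chain2 by fastforce
    moreover have "\<forall>\<^sub>F y in nhds x. y \<in> {0<..<1} - {1 / 2}"
      using x by (intro eventually_nhds_in_open open_Diff) auto
    then have "\<forall>\<^sub>F y in nhds x. (deriv ^^ i) H_fun y
        = (\<Sum>j. (diffs ^^ i) H_coeff j * (y - 1 / 2) ^ j)"
      by eventually_elim (rule eq)
    ultimately show ?thesis
      by (subst DERIV_cong_ev[OF refl _ refl])
  qed
  have eq: "(deriv ^^ i) H_fun x = (\<Sum>j. (diffs ^^ i) H_coeff j * (x - 1 / 2) ^ j)"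
    if "x \<in> {0<..<1} - {1 / 2}" for x i
    using that
  proof (induction i arbitrary: x)
    case 0
    then show ?case
      using H_series_eq_H_fun[of "x - 1 / 2"] abs_minus_half_less[of x] by (simp add: H_series_def)
  next
    case (Suc i)
    from eq_imp_deriv[OF Suc.prems Suc.IH] show ?case
      by (simp add: DERIV_imp_deriv)
  qed
  show "(deriv ^^ i) H_fun x = (\<Sum>j. (diffs ^^ i) H_coeff j * (x - 1 / 2) ^ j)"
    using assms by (rule eq)
  show "(deriv ^^ i) H_fun differentiable (at x)"
    using eq_imp_deriv[OF assms eq] by (auto simp: real_differentiable_def)
qed

lemma absolutely_monotonic_H_fun: "absolutely_monotonic_on H_fun {1 / 2<..<1}"
  unfolding absolutely_monotonic_on_def infinitely_differentiable_on_def
proof (intro conjI allI ballI)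
  fix i and x :: real assume x: "x \<in> {1 / 2<..<1}"
  then have x': "x \<in> {0<..<1} - {1 / 2}" by auto
  show "(deriv ^^ i) H_fun differentiable (at x)"
    by (rule higher_deriv_H_fun(2)[OF x'])
  show "0 \<le> (deriv ^^ i) H_fun x"
    unfolding higher_deriv_H_fun(1)[OF x'] using x
    by (intro suminf_nonneg higher_diffs_H_coeff mult_nonneg_nonneg) auto
qed

lemma completely_monotonic_H_fun: "completely_monotonic_on H_fun {0<..<1 / 2}"
  unfolding completely_monotonic_on_def infinitely_differentiable_on_def
proof (intro conjI allI ballI)
  fix i and x :: real assume x: "x \<in> {0<..<1 / 2}"
  then have x': "x \<in> {0<..<1} - {1 / 2}" by auto
  show "(deriv ^^ i) H_fun differentiable (at x)"
    by (rule higher_deriv_H_fun(2)[OF x'])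
  have nonneg: "(- 1) ^ i * ((diffs ^^ i) H_coeff j * (x - 1 / 2) ^ j) \<ge> 0" for j
  proof (cases "odd (i + j)")
    case True
    then show ?thesis by (simp add: higher_diffs_H_coeff(3))
  next
    case False
    then have "(- 1) ^ i * (x - 1 / 2) ^ j = (1 / 2 - x) ^ j"
      using power_mult_distrib[of "- 1" "1 / 2 - x" j] by (cases "even i") auto
    then have "(- 1) ^ i * ((diffs ^^ i) H_coeff j * (x - 1 / 2) ^ j)
        = (diffs ^^ i) H_coeff j * (1 / 2 - x) ^ j"
      by (simp add: mult_ac)
    also have "\<dots> \<ge> 0"
      using x higher_diffs_H_coeff(2)[of i j] by simp
    finally show ?thesis .
  qed
  have "summable (\<lambda>j. (diffs ^^ i) H_coeff j * (x - 1 / 2) ^ j)"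
    using x by (intro higher_diffs_H_coeff abs_minus_half_less) auto
  from suminf_mult[OF this, of "(- 1) ^ i"] suminf_nonneg[OF summable_mult[OF this] nonneg]
  show "0 \<le> (- 1) ^ i * (deriv ^^ i) H_fun x"
    unfolding higher_deriv_H_fun(1)[OF x'] by simp
qed

section \<open>Boundary values and the best constants\<close>

lemma H_series_0: "H_series 0 = G4_drop_half 1"
  unfolding H_series_def by (subst powser_zero) (simp add: H_coeff_def)

lemma H_series_abs:
  assumes "\<bar>s\<bar> < 1 / 2"
  shows "H_series \<bar>s\<bar> = H_series s"
proof -
  have "(\<lambda>j. H_coeff j * \<bar>s\<bar> ^ j) = (\<lambda>j. H_coeff j * s ^ j)"
    by (auto simp: H_coeff_def power_even_abs)
  then show ?thesis by (simp only: H_series_def)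
qed

text \<open>
  The coefficient of \<open>s\<^sup>2\<close> is positive, which makes the growth strict.
\<close>
lemma H_series_strict_mono:
  assumes "0 \<le> s" "s < t" "t < 1 / 2"
  shows "H_series s < H_series t"
proof -
  have sums: "(\<lambda>j. H_coeff j * t ^ j - H_coeff j * s ^ j) sums (H_series t - H_series s)"
    unfolding H_series_def using assms by (intro sums_diff summable_sums summable_H_coeff) auto
  have "0 < H_coeff 2 * t ^ 2 - H_coeff 2 * s ^ 2"
  proof -
    have "s ^ 2 < t ^ 2" using assms by (intro power_strict_mono) auto
    moreover have "H_coeff 2 > 0" using G4_drop_half_pos[of 3] by (simp add: H_coeff_def)
    ultimately show ?thesis by simp
  qed
  also have "\<dots> = (\<Sum>j\<in>{2}. H_coeff j * t ^ j - H_coeff j * s ^ j)" by simp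
  also have "\<dots> \<le> (\<Sum>j. H_coeff j * t ^ j - H_coeff j * s ^ j)"
    using assms sums H_coeff_nonneg
    by (intro sum_le_suminf) (auto simp: sums_iff intro!: mult_left_mono power_mono)
  also have "\<dots> = H_series t - H_series s"
    using sums by (simp add: sums_iff)
  finally show ?thesis by simp
qed

lemma H_series_tendsto_0: "(H_series \<longlongrightarrow> H_series 0) (at_right 0)"
proof -
  have "(H_series has_real_derivative (\<Sum>j. diffs H_coeff j * 0 ^ j)) (at 0)"
    unfolding H_series_def[abs_def] by (rule termdiffs_strong'[of "1 / 2"])
        (auto intro: summable_H_coeff)
  then have "isCont H_series 0"
    by (rule DERIV_isCont)
  then show ?thesis
    by (auto simp: isCont_def intro: filterlim_at_split[THEN iffD1, THEN conjunct2])
qed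

lemma H_series_tendsto_half: "(H_series \<longlongrightarrow> exp (pi / 2) - 4) (at_left (1 / 2))"
proof -
  have near: "\<forall>\<^sub>F s in at_left (1 / 2). s \<in> {0<..<1 / 2::real}"
    by (rule eventually_at_left_real) simp
  have "((\<lambda>s. G4 (1 / 2 + s)) \<longlongrightarrow> 0) (at_left (1 / 2))"
  proof (rule filterlim_compose[OF G4_tendsto_0])
    show "filterlim (\<lambda>s::real. 1 / 2 + s) (at_left 1) (at_left (1 / 2))"
      by real_asymp
  qed
  moreover have "((\<lambda>s. G4 (1 / 2 - s)) \<longlongrightarrow> exp (pi / 2) - 4) (at_left (1 / 2))"
  proof -
    have "isCont K_series 0"
      using K_series_deriv[of 0] by (intro DERIV_isCont) auto
    then have "(K_series \<longlongrightarrow> pi / 2) (at_right 0)"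
      by (auto simp: isCont_def K_series_0 intro: filterlim_at_split[THEN iffD1, THEN conjunct2])
    moreover have "filterlim (\<lambda>s::real. 1 / 2 - s) (at_right 0) (at_left (1 / 2))"
      by real_asymp
    ultimately have "((\<lambda>s. K_series (1 / 2 - s)) \<longlongrightarrow> pi / 2) (at_left (1 / 2))"
      by (rule filterlim_compose)
    then have "((\<lambda>s. exp (K_series (1 / 2 - s)) - 4 / sqrt (1 / 2 + s))
        \<longlongrightarrow> exp (pi / 2) - 4 / sqrt (1 / 2 + 1 / 2)) (at_left (1 / 2))"
      by (intro tendsto_intros) auto
    moreover have "\<forall>\<^sub>F s in at_left (1 / 2). exp (K_series (1 / 2 - s)) - 4 / sqrt (1 / 2 + s)
        = G4 (1 / 2 - s)"
      using near by eventually_elim (auto simp: G4_eq_K_series)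
    ultimately show ?thesis
      by (simp add: filterlim_cong[OF refl refl])
  qed
  moreover have "((\<lambda>s::real. 2 * s) \<longlongrightarrow> 2 * (1 / 2)) (at_left (1 / 2))"
    by (intro tendsto_intros)
  ultimately have "((\<lambda>s. (G4 (1 / 2 - s) - G4 (1 / 2 + s)) / (2 * s))
      \<longlongrightarrow> (exp (pi / 2) - 4 - 0) / (2 * (1 / 2))) (at_left (1 / 2))"
    by (intro tendsto_divide tendsto_diff) auto
  moreover have "\<forall>\<^sub>F s in at_left (1 / 2). (G4 (1 / 2 - s) - G4 (1 / 2 + s)) / (2 * s) = H_series s"
    using near
  proof eventually_elim
    case (elim s)
    then show ?case
      using H_series_eq_H_fun[of s] by (simp add: H_fun_def divide_simps)
  qed
  ultimately show ?thesis
    by (simp add: filterlim_cong[OF refl refl])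
qed

lemma H_series_less:
  assumes "0 \<le> s" "s < 1 / 2"
  shows "H_series s < exp (pi / 2) - 4"
proof -
  obtain t where t: "s < t" "t < 1 / 2"
    using assms dense by blast
  have "H_series t \<le> exp (pi / 2) - 4"
  proof (rule tendsto_lowerbound[OF H_series_tendsto_half])
    have "\<forall>\<^sub>F r in at_left (1 / 2). r \<in> {t<..<1 / 2}"
      using t by (intro eventually_at_left_real)
    then show "\<forall>\<^sub>F r in at_left (1 / 2). H_series t \<le> H_series r"
    proof eventually_elim
      case (elim r)
      with H_series_strict_mono[of t r] assms t show ?case by simp
    qed
  qed simp
  with H_series_strict_mono[of s t] assms t show ?thesis by linarith
qed

text \<open>
  At \<open>s = 0\<close> the series has the value \<open>G4_drop_half 1 = - G4'(1/2)\<close>, and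
  \<open>G4' = exp K * K' - 2 / sqrt (1 - x) ^ 3\<close>. Legendre's relation gives \<open>K'(1/2) = pi / (2 K(1/2))\<close>, and the
  reflection formula converts the remaining \<open>Gamma (1/4)\<close> to \<open>Gamma (3/4)\<close>.
\<close>
lemma H_series_0_eq:
  "H_series 0 = 4 * sqrt 2 - 1 / sqrt pi * (Gamma (3 / 4))\<^sup>2
      * exp ((Gamma (1 / 4))\<^sup>2 / (4 * sqrt pi))"
proof -
  let ?E = "exp (K_series (1 / 2))"
  have G4_deriv: "((\<lambda>x. exp (K_series x) - 4 / sqrt (1 - x))
      has_real_derivative ?E * step_series (1 / 2) - 4 * sqrt 2) (at (1 / 2))"
  proof -
    have k: "(K_series has_real_derivative step_series (1 / 2)) (at (1 / 2))"
      using K_series_deriv_step_series[of "1 / 2"] by simp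
    have "((\<lambda>x. 4 / sqrt (1 - x)) has_real_derivative 4 * sqrt 2) (at (1 / 2 :: real))"
      by (auto intro!: derivative_eq_intros simp: real_sqrt_divide field_simps)
    from DERIV_diff[OF DERIV_chain2[OF DERIV_exp k] this] show ?thesis .
  qed
  have "((\<lambda>s. \<Sum>j. G4_drop_half j * s ^ j)
      has_real_derivative (\<Sum>j. diffs G4_drop_half j * 0 ^ j)) (at 0)"
    by (rule termdiffs_strong'[of "1 / 2"]) (use G4_drop_half_sums in \<open>auto simp: sums_iff\<close>)
  also have "(\<Sum>j. diffs G4_drop_half j * 0 ^ j) = G4_drop_half 1"
    by (subst powser_zero) (simp add: diffs_def)
  finally have 1: "((\<lambda>s. \<Sum>j. G4_drop_half j * s ^ j) has_real_derivative G4_drop_half 1) (at 0)" .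
  have "((\<lambda>s. 1 / 2 + s) has_real_derivative 1) (at (0::real))"
    by (auto intro!: derivative_eq_intros)
  from DERIV_chain2[OF _ this, of "\<lambda>x. exp (K_series x) - 4 / sqrt (1 - x)" "?E
      * step_series (1 / 2) - 4 * sqrt 2"] G4_deriv
  have "((\<lambda>s. exp (K_series (1 / 2 + s)) - 4 / sqrt (1 - (1 / 2 + s)))
      has_real_derivative ?E * step_series (1 / 2) - 4 * sqrt 2) (at 0)"
    by simp
  from DERIV_diff[OF DERIV_const[of "exp (pi / 2) - 4"] this]
  have 2: "((\<lambda>s. exp (pi / 2) - 4
      - (exp (K_series (1 / 2 + s)) - 4 / sqrt (1 - (1 / 2 + s)))) has_real_derivative
      0 - (?E * step_series (1 / 2) - 4 * sqrt 2)) (at 0)" .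
  have "\<forall>\<^sub>F s in nhds 0. s \<in> {- 1 / 2<..<1 / 2 :: real}"
    by (rule eventually_nhds_in_open) auto
  then have "\<forall>\<^sub>F s in nhds 0. (\<Sum>j. G4_drop_half j * s ^ j)
      = exp (pi / 2) - 4 - (exp (K_series (1 / 2 + s)) - 4 / sqrt (1 - (1 / 2 + s)))"
  proof eventually_elim
    case (elim s)
    then have "\<bar>s\<bar> < 1 / 2" by auto
    with elim G4_drop_half_sums[of s] G4_eq_K_series[of "1 / 2 + s"] show ?case
      by (simp add: sums_iff)
  qed
  from 1[unfolded DERIV_cong_ev[OF refl this refl]] 2
  have "G4_drop_half 1 = 4 * sqrt 2 - step_series (1 / 2) * ?E"
    by (auto dest: DERIV_unique)
  also have "step_series (1 / 2) = 1 / sqrt pi * (Gamma (3 / 4))\<^sup>2"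
  proof -
    define x y :: real where "x = Gamma (1 / 4)" and "y = Gamma (3 / 4)"
    have x: "x > 0" unfolding x_def by (rule Gamma_real_pos) simp
    have xy: "x * y = pi * sqrt 2" unfolding x_def y_def by (rule Gamma_quarter_mult)
    have "step_series (1 / 2) * x\<^sup>2 = 2 * pi * sqrt pi"
      using step_series_half unfolding K_series_half x_def[symmetric] by (simp add: field_simps)
    also have "\<dots> = 1 / sqrt pi * (x * y)\<^sup>2"
      unfolding xy by (simp add: power_mult_distrib field_simps power2_eq_square)
    also have "\<dots> = 1 / sqrt pi * y\<^sup>2 * x\<^sup>2"
      by (simp add: power_mult_distrib)
    finally have "step_series (1 / 2) * x\<^sup>2 = 1 / sqrt pi * y\<^sup>2 * x\<^sup>2" .
    then have "step_series (1 / 2) = 1 / sqrt pi * y\<^sup>2"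
      using x by (simp only: mult_cancel_right) auto
    then show ?thesis by (simp only: y_def)
  qed
  also have "K_series (1 / 2) = (Gamma (1 / 4))\<^sup>2 / (4 * sqrt pi)"
    by (rule K_series_half)
  finally show ?thesis
    by (simp add: H_series_0)
qed

text \<open>
  Using the series in place of \<open>H_fun\<close> covers the removable singularity \<open>r\<^sup>2 = 1/2\<close>, where \<open>H_fun\<close> has
  the default value of a division by zero.
\<close>
lemma K_diff_eq_H_series:
  assumes r: "0 < r" "r < 1"
  shows "K_diff r = H_series (r\<^sup>2 - 1 / 2) * (1 - 2 * r\<^sup>2)"
proof -
  have r2: "0 < r\<^sup>2" "r\<^sup>2 < 1"
    using r by (auto simp: abs_square_less_1)
  have "K_diff r = G4 (r\<^sup>2) - G4 (1 - r\<^sup>2)"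
    using r by (simp add: K_diff_def G4_def)
  also have "\<dots> = H_series (r\<^sup>2 - 1 / 2) * (1 - 2 * r\<^sup>2)"
  proof (cases "r\<^sup>2 = 1 / 2")
    case False
    then have "H_series (r\<^sup>2 - 1 / 2) = (G4 (r\<^sup>2) - G4 (1 - r\<^sup>2)) / (1 - 2 * r\<^sup>2)"
      using H_series_eq_H_fun[of "r\<^sup>2 - 1 / 2"] abs_minus_half_less[of "r\<^sup>2"] r2 by
          (simp add: H_fun_def)
    with False show ?thesis by (simp add: field_simps)
  next
    case True
    then show ?thesis by (simp add: True)
  qed
  finally show ?thesis .
qed

lemma H_series_bounds:
  assumes "\<bar>s\<bar> < 1 / 2" "s \<noteq> 0"
  shows "H_series 0 < H_series s" "H_series s < exp (pi / 2) - 4"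
  using H_series_strict_mono[of 0 "\<bar>s\<bar>"] H_series_less[of "\<bar>s\<bar>"] H_series_abs[of s] assms by auto

text \<open>
  The points \<open>r\<close> with \<open>r\<^sup>2 = 1/2 - s\<close> witness sharpness: \<open>s\<close> near \<open>1/2\<close> for the upper constant and \<open>s\<close>
  near \<open>0\<close> for the lower one.
\<close>
lemma K_diff_at_offset:
  assumes "0 < s" "s < 1 / 2"
  shows "sqrt (1 / 2 - s) \<in> {0<..<1 / sqrt 2}"
    and "K_diff (sqrt (1 / 2 - s)) = H_series s * (1 - 2 * (sqrt (1 / 2 - s))\<^sup>2)"
proof -
  have "sqrt (1 / 2 - s) < sqrt (1 / 2)"
    using assms by (intro real_sqrt_less_mono) auto
  then show "sqrt (1 / 2 - s) \<in> {0<..<1 / sqrt 2}"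
    using assms by (simp add: real_sqrt_divide)
  have "H_series (- s) = H_series s"
    using H_series_abs[of "- s"] H_series_abs[of s] assms by simp
  moreover have "sqrt (1 / 2 - s) < 1"
    using assms by (subst real_sqrt_lt_1_iff) auto
  ultimately show "K_diff (sqrt (1 / 2 - s)) = H_series s * (1 - 2 * (sqrt (1 / 2 - s))\<^sup>2)"
    using assms by (subst K_diff_eq_H_series) auto
qed

theorem proposition4:
  fixes \<alpha> \<beta> :: real
  assumes \<alpha>: "\<alpha> = exp (pi / 2) - 4"
    and \<beta>: "\<beta> = 4 * sqrt 2 - 1 / sqrt pi * (Gamma (3 / 4))\<^sup>2 * exp ((Gamma (1 / 4))\<^sup>2 / (4 * sqrt pi))"
  shows "(\<forall>x\<in>{0<..<1} - {1 / 2}. H_fun x =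
            1 / (1 - 2 * x) * (exp (elliptic_K (sqrt x)) - exp (elliptic_K (sqrt (1 - x)))
                               + 4 / sqrt x - 4 / sqrt (1 - x)))
    \<and> completely_monotonic_on H_fun {0<..<1 / 2}
    \<and> absolutely_monotonic_on H_fun {1 / 2<..<1}
    \<and> (\<forall>r\<in>{0<..<1 / sqrt 2}. \<beta> * (1 - 2 * r\<^sup>2) < K_diff r \<and> K_diff r < \<alpha> * (1 - 2 * r\<^sup>2))
    \<and> (\<forall>a<\<alpha>. \<not> (\<forall>r\<in>{0<..<1 / sqrt 2}. K_diff r < a * (1 - 2 * r\<^sup>2)))
    \<and> (\<forall>b>\<beta>. \<not> (\<forall>r\<in>{0<..<1 / sqrt 2}. b * (1 - 2 * r\<^sup>2) < K_diff r))
    \<and> (\<forall>r\<in>{1 / sqrt 2<..<1}. \<beta> * (1 - 2 * r\<^sup>2) > K_diff r \<and> K_diff r > \<alpha> * (1 - 2 * r\<^sup>2))"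
proof (intro conjI ballI allI impI)
  show "H_fun x = 1 / (1 - 2 * x) * (exp (elliptic_K (sqrt x)) - exp (elliptic_K (sqrt (1 - x)))
                               + 4 / sqrt x - 4 / sqrt (1 - x))" for x
  proof -
    have "G4 x - G4 (1 - x) = exp (elliptic_K (sqrt x)) - exp (elliptic_K (sqrt (1 - x)))
        + 4 / sqrt x - 4 / sqrt (1 - x)"
      by (simp add: G4_def)
    then show ?thesis
      by (simp add: H_fun_def)
  qed
  show "completely_monotonic_on H_fun {0<..<1 / 2}"
    by (rule completely_monotonic_H_fun)
  show "absolutely_monotonic_on H_fun {1 / 2<..<1}"
    by (rule absolutely_monotonic_H_fun)
next
  fix r :: real assume r: "r \<in> {0<..<1 / sqrt 2}"
  have "r < 1 / sqrt 2" using r by simp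
  also have "\<dots> < 1" by simp
  finally have r1: "0 < r" "r < 1" using r by auto
  have "r\<^sup>2 < (1 / sqrt 2)\<^sup>2" using r by (intro power_strict_mono) auto
  then have r2: "0 < r\<^sup>2" "r\<^sup>2 < 1 / 2" using r1 by (auto simp: power_divide)
  then have "\<bar>r\<^sup>2 - 1 / 2\<bar> < 1 / 2" "r\<^sup>2 - 1 / 2 \<noteq> 0"
    by (auto intro!: abs_minus_half_less)
  note bounds = H_series_bounds[OF this]
  show "\<beta> * (1 - 2 * r\<^sup>2) < K_diff r" "K_diff r < \<alpha> * (1 - 2 * r\<^sup>2)"
    unfolding K_diff_eq_H_series[OF r1] using bounds r2 \<alpha> \<beta> H_series_0_eq
    by (auto intro!: mult_strict_right_mono)
next
  fix r :: real assume r: "r \<in> {1 / sqrt 2<..<1}"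
  have "0 < 1 / sqrt (2::real)" by simp
  also have "\<dots> < r" using r by simp
  finally have r1: "0 < r" "r < 1" using r by auto
  have "(1 / sqrt 2)\<^sup>2 < r\<^sup>2" using r by (intro power_strict_mono) auto
  then have r2: "1 / 2 < r\<^sup>2" by (simp add: power_divide)
  have "r\<^sup>2 < 1" using r1 by (simp add: abs_square_less_1)
  with r2 have "\<bar>r\<^sup>2 - 1 / 2\<bar> < 1 / 2" "r\<^sup>2 - 1 / 2 \<noteq> 0"
    by (auto intro!: abs_minus_half_less)
  note bounds = H_series_bounds[OF this]
  show "\<beta> * (1 - 2 * r\<^sup>2) > K_diff r" "K_diff r > \<alpha> * (1 - 2 * r\<^sup>2)"
    unfolding K_diff_eq_H_series[OF r1] using bounds r2 \<alpha> \<beta> H_series_0_eq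
    by (auto intro!: mult_strict_right_mono_neg)
next
  fix a assume "a < \<alpha>"
  then have "\<forall>\<^sub>F s in at_left (1 / 2). a < H_series s"
    using H_series_tendsto_half unfolding \<alpha> by (auto intro: order_tendstoD)
  moreover have "\<forall>\<^sub>F s in at_left (1 / 2). s \<in> {0<..<1 / 2::real}"
    by (rule eventually_at_left_real) simp
  ultimately have "\<forall>\<^sub>F s in at_left (1 / 2). s \<in> {0<..<1 / 2} \<and> a < H_series s"
    by eventually_elim auto
  then obtain s where s: "0 < s" "s < 1 / 2" "a < H_series s"
    by (auto dest!: eventually_happens)
  then have "K_diff (sqrt (1 / 2 - s)) \<ge> a * (1 - 2 * (sqrt (1 / 2 - s))\<^sup>2)"
    unfolding K_diff_at_offset(2)[OF s(1,2)] by (intro mult_right_mono) auto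
  with K_diff_at_offset(1)[OF s(1,2)]
  show "\<not> (\<forall>r\<in>{0<..<1 / sqrt 2}. K_diff r < a * (1 - 2 * r\<^sup>2))"
    by (meson not_le)
next
  fix b assume "b > \<beta>"
  then have "\<forall>\<^sub>F s in at_right 0. H_series s < b"
    using H_series_tendsto_0 unfolding \<beta> H_series_0_eq by (auto intro: order_tendstoD)
  moreover have "\<forall>\<^sub>F s in at_right 0. s \<in> {0<..<1 / 2::real}"
    by (rule eventually_at_right_real) simp
  ultimately have "\<forall>\<^sub>F s in at_right 0. s \<in> {0<..<1 / 2} \<and> H_series s < b"
    by eventually_elim auto
  then obtain s where s: "0 < s" "s < 1 / 2" "H_series s < b"
    by (auto dest!: eventually_happens)
  then have "K_diff (sqrt (1 / 2 - s)) \<le> b * (1 - 2 * (sqrt (1 / 2 - s))\<^sup>2)"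
    unfolding K_diff_at_offset(2)[OF s(1,2)] by (intro mult_right_mono) auto
  with K_diff_at_offset(1)[OF s(1,2)]
  show "\<not> (\<forall>r\<in>{0<..<1 / sqrt 2}. b * (1 - 2 * r\<^sup>2) < K_diff r)"
    by (meson not_le)
qed

end
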